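(* For all integers $p\ge 2$ and $m\ge 0$, the two quadratic Euler sums \[\sum_{n=1}^\infty \frac{\zeta_n(p)\,\zeta_n(p+2m+1)}{n}(-1)^{n-1},\qquad \sum_{n=1}^\infty \frac{L_n(p)\,L_n(p+2m+1)}{n}(-1)^{n-1}\] are reducible to linear sums, i.e. each of them can be written as a polynomial with rational coefficients in $\ln 2$, the values $\zeta(k)$ $(k\ge 2)$, the values $\bar\zeta(k)$ $(k\ge 1)$, and convergent linear Euler sums of the four forms \[\sum_{n\ge1}\frac{\zeta_n(a)}{n^b},\quad \sum_{n\ge1}\frac{\zeta_n(a)}{n^b}(-1)^{n-1},\quad \sum_{n\ge1}\frac{L_n(a)}{n^b},\quad \sum_{n\ge1}\frac{L_n(a)}{n^b}(-1)^{n-1}\qquad (a\ge1,\ b\ge 2 \text{ integers}).\]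
   Context: For positive integers $n,k$: $\zeta_n(k)=\sum_{j=1}^n j^{-k}$ and $L_n(k)=\sum_{j=1}^n (-1)^{j-1}j^{-k}$ (so $\zeta_n(1)=H_n$ is the $n$-th harmonic number). $\zeta(s)=\sum_{n\ge1}n^{-s}$ is the Riemann zeta function and $\bar\zeta(s)=\sum_{n\ge1}(-1)^{n-1}n^{-s}$ the alternating zeta function (so $\bar\zeta(1)=\ln 2$). "Reducible to linear sums" is the paper's term, meaning expressible through zeta values and linear Euler sums as described in the claim. *)

theory Defs
  imports Complex_Main
begin

definition zeta_part :: "nat \<Rightarrow> nat \<Rightarrow> real" where
  "zeta_part n k = (\<Sum>j=1..n. 1 / real j ^ k)"

definition L_part :: "nat \<Rightarrow> nat \<Rightarrow> real" where
  "L_part n k = (\<Sum>j=1..n. (-1) ^ (j - 1) / real j ^ k)"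

text \<open>Infinite series over \<open>n \<ge> 1\<close> are indexed from 0, with \<open>Suc n\<close> in place of the
  summation index; the sign \<open>(-1)^(n-1)\<close> thus becomes \<open>(-1)^n\<close>.  The series are ordered
  (\<open>suminf\<close>, \<open>sums\<close>), as some of them converge only conditionally.\<close>

definition zeta_val :: "nat \<Rightarrow> real" where
  "zeta_val k = (\<Sum>n. 1 / real (Suc n) ^ k)"

definition alt_zeta_val :: "nat \<Rightarrow> real" where
  "alt_zeta_val k = (\<Sum>n. (-1) ^ n / real (Suc n) ^ k)"

definition linear_sum :: "(nat \<Rightarrow> nat \<Rightarrow> real) \<Rightarrow> nat \<Rightarrow> nat \<Rightarrow> real" where
  "linear_sum F a b = (\<Sum>n. F (Suc n) a / real (Suc n) ^ b)"

definition alt_linear_sum :: "(nat \<Rightarrow> nat \<Rightarrow> real) \<Rightarrow> nat \<Rightarrow> nat \<Rightarrow> real" where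
  "alt_linear_sum F a b = (\<Sum>n. F (Suc n) a / real (Suc n) ^ b * (-1) ^ n)"

text \<open>The bounds on \<open>k\<close> and \<open>b\<close> make every series below convergent, so no \<open>suminf\<close>
  takes an unspecified value.\<close>

definition euler_generators :: "real set" where
  "euler_generators =
     {ln 2} \<union> {zeta_val k | k. k \<ge> 2} \<union> {alt_zeta_val k | k. k \<ge> 1}
     \<union> {linear_sum zeta_part a b | a b. a \<ge> 1 \<and> b \<ge> 2}
     \<union> {alt_linear_sum zeta_part a b | a b. a \<ge> 1 \<and> b \<ge> 2}
     \<union> {linear_sum L_part a b | a b. a \<ge> 1 \<and> b \<ge> 2}
     \<union> {alt_linear_sum L_part a b | a b. a \<ge> 1 \<and> b \<ge> 2}"

text \<open>Values of polynomials with rational coefficients at finitely many elements of \<open>S\<close>: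
  \<open>T\<close> is the set of elements occurring, \<open>M\<close> the set of exponent vectors of the monomials,
  and \<open>c\<close> gives the coefficients.\<close>

definition rat_poly_values :: "real set \<Rightarrow> real set" where
  "rat_poly_values S =
     {x. \<exists>(T :: real set) (M :: (real \<Rightarrow> nat) set) (c :: (real \<Rightarrow> nat) \<Rightarrow> rat).
           finite T \<and> T \<subseteq> S \<and> finite M \<and>
           x = (\<Sum>e\<in>M. of_rat (c e) * (\<Prod>s\<in>T. s ^ e s))}"

text \<open>Convergence of the series is part of the claim that its sum is reducible.\<close>

definition reducible_to_linear_sums :: "(nat \<Rightarrow> real) \<Rightarrow> bool" where
  "reducible_to_linear_sums f \<longleftrightarrow> (\<exists>x \<in> rat_poly_values euler_generators. f sums x)"

end

theory Submission
  imports Defs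
begin

text \<open>
  This is the parity phenomenon for sums of even weight and depth three.  Put
  \<open>U k n = \<Sum>j. \<sigma>^(j+n) / (j-n)^k\<close> over \<open>1 \<le> j \<le> M\<close>, \<open>j \<noteq> n\<close>, for every integer \<open>n\<close>, where
  \<open>\<sigma> = 1\<close> gives \<open>\<zeta>\<^sub>n\<close> and \<open>\<sigma> = -1\<close> gives \<open>- L\<^sub>n\<close>, and sum \<open>(-1)^n/n * U p n * U q n\<close> over
  \<open>0 < \<bar>n\<bar> \<le> M\<close> in two ways.

  On the one hand, as \<open>M \<rightarrow> \<infinity>\<close>, \<open>U k n\<close> tends to a constant plus \<open>(-1)^k\<close> times a partial sum up to
  \<open>n - 1\<close>, and \<open>U k (-n)\<close> to the same constant minus the partial sum up to \<open>n\<close>.  As \<open>p + q\<close> is odd,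
  the contributions of \<open>n\<close> and \<open>-n\<close> add up to \<open>-2\<close> times the quadratic sum, up to linear sums.

  On the other hand, partial fractions in \<open>n\<close> write the product \<open>U p n * U q n\<close> as a rational combination of
  \<open>\<Sum>j. U (p+q-i) j / (j-n)^i\<close>, with \<open>p + q - i \<ge> 2\<close>.  After exchanging the sums, the sum over \<open>n\<close> is
  explicit because it is bilateral, so what remains is linear.

  A linear sum whose denominator is \<open>n\<close> itself is brought to one of the admitted forms by the product
  formula for two partial sums.
\<close>

section \<open>Polynomial values with rational coefficients\<close>

text \<open>Monomials indexed by an arbitrary finite set may repeat an exponent vector; collecting
  equal vectors and adding their coefficients gives the form in the definition. Closure under sums
  and products then needs no merging of terms.\<close>

lemma rat_poly_values_indexed:
  fixes E :: "'i \<Rightarrow> real \<Rightarrow> nat"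
  assumes "finite T" "T \<subseteq> S" "finite I"
  shows "(\<Sum>i\<in>I. of_rat (d i) * (\<Prod>s\<in>T. s ^ E i s)) \<in> rat_poly_values S"
proof -
  have "(\<Sum>i\<in>I. of_rat (d i) * (\<Prod>s\<in>T. s ^ E i s))
      = (\<Sum>e\<in>E ` I. \<Sum>i\<in>{i\<in>I. E i = e}. of_rat (d i) * (\<Prod>s\<in>T. s ^ E i s))"
    by (rule sum.image_gen[OF assms(3)])
  also have "\<dots> = (\<Sum>e\<in>E ` I. of_rat (\<Sum>i\<in>{i\<in>I. E i = e}. d i) * (\<Prod>s\<in>T. s ^ e s))"
    by (intro sum.cong) (auto simp: of_rat_sum sum_distrib_right intro!: sum.cong)
  finally show ?thesis
    unfolding rat_poly_values_def
    using assms by (auto intro!: exI[of _ T] exI[of _ "E ` I"] exI[of _ "\<lambda>e. \<Sum>i\<in>{i\<in>I. E i = e}. d i"])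
qed

text \<open>A generator outside \<open>T\<close> enters with exponent 0, so two values can be
  written over one common set of generators.\<close>

lemma rat_poly_values_enlarge:
  assumes "x \<in> rat_poly_values S"
  shows "\<exists>T. finite T \<and> T \<subseteq> S \<and> (\<forall>T'. finite T' \<and> T \<subseteq> T' \<longrightarrow>
     (\<exists>(I :: (real \<Rightarrow> nat) set) d E. finite I \<and> x = (\<Sum>i\<in>I. of_rat (d i) * (\<Prod>s\<in>T'. s ^ E i s))))"
proof -
  obtain T M c where T: "finite T" "T \<subseteq> S" "finite (M :: (real \<Rightarrow> nat) set)"
    and x: "x = (\<Sum>e\<in>M. of_rat (c e) * (\<Prod>s\<in>T. s ^ e s))"
    using assms unfolding rat_poly_values_def by blast
  show ?thesis
  proof (intro exI[of _ T] conjI T(1,2) allI impI, elim conjE)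
    fix T' assume T': "finite T'" "T \<subseteq> T'"
    have "(\<Prod>s\<in>T. s ^ e s) = (\<Prod>s\<in>T'. s ^ (if s \<in> T then e s else 0))" for e :: "real \<Rightarrow> nat"
      using T' by (intro prod.mono_neutral_cong_left) auto
    then show "\<exists>(I :: (real \<Rightarrow> nat) set) d E. finite I \<and> x = (\<Sum>i\<in>I. of_rat (d i) * (\<Prod>s\<in>T'. s ^ E i s))"
      using T(3) x
      by (intro exI[of _ M] exI[of _ c] exI[of _ "\<lambda>e s. if s \<in> T then e s else 0"]) simp
  qed
qed

lemma rat_poly_values_common:
  assumes "x \<in> rat_poly_values S" "y \<in> rat_poly_values S"
  obtains T and I J :: "(real \<Rightarrow> nat) set" and d D E F where "finite T" "T \<subseteq> S" "finite I" "finite J"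
    "x = (\<Sum>i\<in>I. of_rat (d i) * (\<Prod>s\<in>T. s ^ E i s))"
    "y = (\<Sum>i\<in>J. of_rat (D i) * (\<Prod>s\<in>T. s ^ F i s))"
proof -
  obtain T1 where T1: "finite T1" "T1 \<subseteq> S" "\<forall>T'. finite T' \<and> T1 \<subseteq> T' \<longrightarrow>
     (\<exists>(I :: (real \<Rightarrow> nat) set) d E. finite I \<and> x = (\<Sum>i\<in>I. of_rat (d i) * (\<Prod>s\<in>T'. s ^ E i s)))"
    using rat_poly_values_enlarge[OF assms(1)] by blast
  obtain T2 where T2: "finite T2" "T2 \<subseteq> S" "\<forall>T'. finite T' \<and> T2 \<subseteq> T' \<longrightarrow>
     (\<exists>(I :: (real \<Rightarrow> nat) set) d E. finite I \<and> y = (\<Sum>i\<in>I. of_rat (d i) * (\<Prod>s\<in>T'. s ^ E i s)))"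
    using rat_poly_values_enlarge[OF assms(2)] by blast
  show ?thesis
    using T1(3)[rule_format, of "T1 \<union> T2"] T2(3)[rule_format, of "T1 \<union> T2"] T1(1,2) T2(1,2)
      that[of "T1 \<union> T2"] by auto
qed

lemma rat_poly_values_add:
  assumes "x \<in> rat_poly_values S" "y \<in> rat_poly_values S"
  shows "x + y \<in> rat_poly_values S"
proof -
  obtain T and I J :: "(real \<Rightarrow> nat) set" and d D E F where *: "finite T" "T \<subseteq> S" "finite I" "finite J"
    "x = (\<Sum>i\<in>I. of_rat (d i) * (\<Prod>s\<in>T. s ^ E i s))"
    "y = (\<Sum>i\<in>J. of_rat (D i) * (\<Prod>s\<in>T. s ^ F i s))"
    using assms by (rule rat_poly_values_common)
  have "x + y = (\<Sum>i\<in>I <+> J. of_rat (case_sum d D i) * (\<Prod>s\<in>T. s ^ case_sum E F i s))"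
    using * by (simp add: sum.Plus)
  then show ?thesis
    using rat_poly_values_indexed[of T S "I <+> J"] * by (simp only: finite_Plus)
qed

lemma rat_poly_values_mult:
  assumes "x \<in> rat_poly_values S" "y \<in> rat_poly_values S"
  shows "x * y \<in> rat_poly_values S"
proof -
  obtain T and I J :: "(real \<Rightarrow> nat) set" and d D E F where *: "finite T" "T \<subseteq> S" "finite I" "finite J"
    "x = (\<Sum>i\<in>I. of_rat (d i) * (\<Prod>s\<in>T. s ^ E i s))"
    "y = (\<Sum>i\<in>J. of_rat (D i) * (\<Prod>s\<in>T. s ^ F i s))"
    using assms by (rule rat_poly_values_common)
  have "x * y = (\<Sum>i\<in>I \<times> J. of_rat (d (fst i) * D (snd i)) * (\<Prod>s\<in>T. s ^ (E (fst i) s + F (snd i) s)))"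
    unfolding *(5,6) sum_product sum.cartesian_product
    by (intro sum.cong) (auto simp: power_add prod.distrib of_rat_mult)
  then show ?thesis
    using rat_poly_values_indexed[of T S "I \<times> J"] * by (simp only: finite_cartesian_product)
qed

lemma rat_poly_values_rat: "of_rat r \<in> rat_poly_values S"
  using rat_poly_values_indexed[of "{}" S "{()}" "\<lambda>_. r"] by simp

lemma rat_poly_values_gen: "s \<in> S \<Longrightarrow> s \<in> rat_poly_values S"
  using rat_poly_values_indexed[of "{s}" S "{()}" "\<lambda>_. 1" "\<lambda>_ _. 1"] by simp

lemma rat_poly_values_of_int: "of_int k \<in> rat_poly_values S"
  by (metis of_rat_of_int_eq rat_poly_values_rat)

lemma rat_poly_values_minus: "x \<in> rat_poly_values S \<Longrightarrow> - x \<in> rat_poly_values S"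
  using rat_poly_values_mult[of "of_int (-1)" S x] rat_poly_values_of_int[of "-1" S] by simp

section \<open>Series whose sum lies in the algebra\<close>

abbreviation "euler_algebra \<equiv> rat_poly_values euler_generators"

text \<open>\<open>g\<close> is written in the natural index starting at 1; its value at 0, where
  denominators vanish, never enters.\<close>

definition summable_in_algebra :: "(nat \<Rightarrow> real) \<Rightarrow> bool" where
  "summable_in_algebra g \<longleftrightarrow> (\<exists>x \<in> euler_algebra. (\<lambda>n. g (Suc n)) sums x)"

lemma summable_in_algebra_add:
  "summable_in_algebra f \<Longrightarrow> summable_in_algebra g \<Longrightarrow> summable_in_algebra (\<lambda>n. f n + g n)"
  unfolding summable_in_algebra_def by (elim bexE, rule bexI, rule sums_add) (assumption | rule rat_poly_values_add)+

lemma summable_in_algebra_mult: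
  "c \<in> euler_algebra \<Longrightarrow> summable_in_algebra f \<Longrightarrow> summable_in_algebra (\<lambda>n. c * f n)"
  unfolding summable_in_algebra_def by (elim bexE, rule bexI, rule sums_mult) (assumption | rule rat_poly_values_mult)+

lemma summable_in_algebra_minus:
  "summable_in_algebra f \<Longrightarrow> summable_in_algebra (\<lambda>n. - f n)"
  unfolding summable_in_algebra_def by (elim bexE, rule bexI, rule sums_minus) (assumption | rule rat_poly_values_minus)+

lemma summable_in_algebra_diff:
  "summable_in_algebra f \<Longrightarrow> summable_in_algebra g \<Longrightarrow> summable_in_algebra (\<lambda>n. f n - g n)"
  using summable_in_algebra_add[OF _ summable_in_algebra_minus, of f g] by simp

lemma summable_in_algebra_sum:
  "finite I \<Longrightarrow> (\<And>i. i \<in> I \<Longrightarrow> summable_in_algebra (f i)) \<Longrightarrow> summable_in_algebra (\<lambda>n. \<Sum>i\<in>I. f i n)"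
proof (induction I rule: finite_induct)
  case empty
  have "(\<lambda>n::nat. 0::real) sums of_int 0" by simp
  then show ?case unfolding summable_in_algebra_def
    using rat_poly_values_of_int[of 0 euler_generators] by force
qed (auto intro: summable_in_algebra_add)

lemma summable_in_algebra_cong:
  assumes "summable_in_algebra f" "\<And>n. n \<ge> 1 \<Longrightarrow> f n = g n"
  shows "summable_in_algebra g"
  using assms unfolding summable_in_algebra_def by simp

section \<open>Linear sums\<close>

text \<open>The sign \<open>\<sigma> ^ j\<close> is multiplicative: a product of terms with signs
  \<open>\<sigma>\<close> and \<open>\<tau>\<close> has sign
  \<open>\<sigma> * \<tau>\<close>.\<close>

definition Z :: "real \<Rightarrow> nat \<Rightarrow> nat \<Rightarrow> real" where
  "Z \<sigma> n k = (\<Sum>j=1..n. \<sigma> ^ j / real j ^ k)"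

lemma Z_0 [simp]: "Z \<sigma> 0 k = 0"
  by (simp add: Z_def)

lemma Z_Suc: "Z \<sigma> (Suc n) k = Z \<sigma> n k + \<sigma> ^ Suc n / real (Suc n) ^ k"
  by (simp add: Z_def)

lemma Z_pos: "Z 1 n k = zeta_part n k"
  by (simp add: Z_def zeta_part_def)

lemma Z_neg: "Z (-1) n k = - L_part n k"
  unfolding Z_def L_part_def sum_negf[symmetric]
proof (intro sum.cong refl)
  fix j assume "j \<in> {1..n}"
  then obtain i where "j = Suc i" by (cases j) auto
  then show "(- 1) ^ j / real j ^ k = - ((- 1) ^ (j - 1) / real j ^ k)" by simp
qed

definition sign :: "real \<Rightarrow> bool" where "sign \<sigma> \<longleftrightarrow> \<sigma> = 1 \<or> \<sigma> = -1"

lemma sign_simps [simp]: "sign 1" "sign (-1)"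
  by (auto simp: sign_def)

lemma sign_mult: "sign \<sigma> \<Longrightarrow> sign \<tau> \<Longrightarrow> sign (\<sigma> * \<tau>)"
  by (auto simp: sign_def)

lemma sign_abs_power: "sign \<sigma> \<Longrightarrow> \<bar>\<sigma> ^ n\<bar> = 1"
  by (auto simp: sign_def)

text \<open>The condition for \<open>\<Sum>n. \<tau> ^ n / n ^ b\<close> to converge.\<close>

definition admissible :: "real \<Rightarrow> nat \<Rightarrow> bool" where
  "admissible \<tau> b \<longleftrightarrow> sign \<tau> \<and> b \<ge> 1 \<and> (\<tau> = -1 \<or> b \<ge> 2)"

section \<open>Convergence of the partial sums, with a rate\<close>

definition Z_lim :: "real \<Rightarrow> nat \<Rightarrow> real" where
  "Z_lim \<sigma> k = lim (\<lambda>n. Z \<sigma> n k)"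

text \<open>Telescoping: with \<open>m = n + d + 1\<close>, each new term is at most
  \<open>1 / m ^ 2 \<le> 2 / m - 2 / (m + 1)\<close>.\<close>

lemma Z_tail_zeta:
  assumes "k \<ge> 2"
  shows "zeta_part (n + d) k - zeta_part n k \<le> 2 / real (n + 1) - 2 / real (n + d + 1)"
proof (induction d)
  case (Suc d)
  have "real (n + d + 1) ^ 2 \<le> real (n + d + 1) ^ k"
    using assms by (intro power_increasing) auto
  then have "1 / real (n + d + 1) ^ k \<le> 1 / real (n + d + 1) ^ 2"
    by (intro divide_left_mono) auto
  also have "\<dots> \<le> 2 / (real (n + d + 1) * real (n + d + 2))"
    by (simp add: divide_simps power2_eq_square) (simp add: algebra_simps)?
  also have "\<dots> = 2 / real (n + d + 1) - 2 / real (n + d + 2)"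
    by (simp add: divide_simps)
  finally show ?case
    using Suc by (simp add: zeta_part_def add_ac)
qed simp

lemma Z_lim_pos:
  assumes "k \<ge> 2"
  shows "(\<lambda>n. Z 1 n k) \<longlonglongrightarrow> Z_lim 1 k" "\<bar>Z_lim 1 k - Z 1 n k\<bar> \<le> 2 / real (n + 1)"
proof -
  have sm: "summable (\<lambda>n. 1 / real (Suc n) ^ k)"
  proof (rule summableI_nonneg_bounded)
    fix n
    have "(\<Sum>i<n. 1 / real (Suc i) ^ k) = zeta_part n k"
      unfolding zeta_part_def One_nat_def sum.atLeast1_atMost_eq by simp
    also have "\<dots> \<le> 2 - 2 / real (n + 1)"
      using Z_tail_zeta[OF assms, of 0 n] by (simp add: zeta_part_def)
    also have "\<dots> \<le> 2" by simp
    finally show "(\<Sum>i<n. 1 / real (Suc i) ^ k) \<le> 2" .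
  qed simp
  have "convergent (\<lambda>n. Z 1 n k)"
    using sm unfolding summable_iff_convergent Z_pos zeta_part_def One_nat_def sum.atLeast1_atMost_eq by simp
  then show lim: "(\<lambda>n. Z 1 n k) \<longlonglongrightarrow> Z_lim 1 k"
    unfolding Z_lim_def by (simp add: convergent_LIMSEQ_iff)
  have "(\<lambda>d. Z 1 (d + n) k - Z 1 n k) \<longlonglongrightarrow> Z_lim 1 k - Z 1 n k"
    by (intro tendsto_intros LIMSEQ_ignore_initial_segment lim)
  then have "(\<lambda>d. \<bar>Z 1 (d + n) k - Z 1 n k\<bar>) \<longlonglongrightarrow> \<bar>Z_lim 1 k - Z 1 n k\<bar>"
    by (rule tendsto_rabs)
  moreover have "\<bar>Z 1 (d + n) k - Z 1 n k\<bar> \<le> 2 / real (n + 1)" for d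
  proof -
    have "zeta_part n k \<le> zeta_part (d + n) k"
      unfolding zeta_part_def by (intro sum_mono2) auto
    moreover have "zeta_part (d + n) k - zeta_part n k \<le> 2 / real (n + 1) - 2 / real (n + d + 1)"
      using Z_tail_zeta[OF assms, of n d] by (simp only: add.commute)
    moreover have "2 / real (n + d + 1) \<ge> 0" by simp
    ultimately show ?thesis unfolding Z_pos by linarith
  qed
  ultimately show "\<bar>Z_lim 1 k - Z 1 n k\<bar> \<le> 2 / real (n + 1)"
    by (intro LIMSEQ_le_const2) auto
qed

text \<open>By the Leibniz criterion the limit lies between consecutive partial sums, so the error
  is at most the first omitted term. The constant 2 only makes the rate agree with that for
  \<open>\<sigma> = 1\<close>.\<close>

lemma Z_lim_neg:
  assumes "k \<ge> 1"
  shows "(\<lambda>n. Z (-1) n k) \<longlonglongrightarrow> Z_lim (-1) k" "\<bar>Z_lim (-1) k - Z (-1) n k\<bar> \<le> 2 / real (n + 1)"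
proof -
  define a where "a = (\<lambda>n. 1 / real (Suc n) ^ k)"
  have a0: "a \<longlonglongrightarrow> 0"
  proof (rule tendsto_sandwich[of "\<lambda>_. 0" _ _ "\<lambda>n. 1 / real (Suc n)"])
    have "real (Suc n) ^ 1 \<le> real (Suc n) ^ k" for n using assms by (intro power_increasing) auto
    then show "\<forall>\<^sub>F n in sequentially. a n \<le> 1 / real (Suc n)"
      unfolding a_def by (intro always_eventually allI divide_left_mono) auto
    show "(\<lambda>n. 1 / real (Suc n)) \<longlonglongrightarrow> 0"
      using LIMSEQ_inverse_real_of_nat by (simp add: inverse_eq_divide)
  qed (auto simp: a_def)
  have mono: "a (Suc n) \<le> a n" for n
    unfolding a_def by (intro divide_left_mono power_mono) auto
  have m: "monoseq a" unfolding monoseq_Suc using mono by blast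
  have pos: "0 \<le> a n" for n by (simp add: a_def)
  have Zeq: "Z (-1) n k = - (\<Sum>i<n. (-1) ^ i * a i)" for n
    unfolding Z_def One_nat_def sum.atLeast1_atMost_eq a_def by (simp add: sum_negf)
  have sm: "summable (\<lambda>n. (-1) ^ n * a n)"
    by (rule summable_Leibniz(1)[OF a0 m])
  then have l: "(\<lambda>n. Z (-1) n k) \<longlonglongrightarrow> - (\<Sum>n. (-1) ^ n * a n)"
    unfolding Zeq by (intro tendsto_minus summable_LIMSEQ)
  then have e: "Z_lim (-1) k = - (\<Sum>n. (-1) ^ n * a n)"
    unfolding Z_lim_def by (rule limI)
  with l show "(\<lambda>n. Z (-1) n k) \<longlonglongrightarrow> Z_lim (-1) k" by simp
  let ?s = "\<Sum>n. (-1) ^ n * a n"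
  have lo: "(\<Sum>i<2*m. (-1)^i * a i) \<le> ?s" and hi: "?s \<le> (\<Sum>i<2*m+1. (-1)^i * a i)" for m
    using summable_Leibniz'(2,4)[OF a0 pos mono] by auto
  have "\<bar>?s - (\<Sum>i<n. (-1) ^ i * a i)\<bar> \<le> a n"
  proof (cases "even n")
    case True
    then obtain m where "n = 2 * m" by (elim evenE)
    then show ?thesis using lo[of m] hi[of m] by auto
  next
    case False
    then obtain m where m: "n = 2 * m + 1" by (elim oddE)
    have "2 * (m + 1) = Suc n" using m by simp
    then show ?thesis using lo[of "m+1"] hi[of m] m by auto
  qed
  also have "a n \<le> 2 / real (n + 1)"
  proof -
    have "real (Suc n) ^ 1 \<le> real (Suc n) ^ k" using assms by (intro power_increasing) auto
    then have "a n \<le> 1 / real (Suc n)" unfolding a_def by (intro divide_left_mono) auto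
    also have "\<dots> \<le> 2 / real (n + 1)" by (simp add: divide_simps)
    finally show ?thesis .
  qed
  finally show "\<bar>Z_lim (-1) k - Z (-1) n k\<bar> \<le> 2 / real (n + 1)"
    unfolding e Zeq by simp
qed

lemma Z_tendsto: "admissible \<sigma> k \<Longrightarrow> (\<lambda>n. Z \<sigma> n k) \<longlonglongrightarrow> Z_lim \<sigma> k"
  using Z_lim_pos(1) Z_lim_neg(1) by (auto simp: admissible_def sign_def)

lemma Z_error: "admissible \<sigma> k \<Longrightarrow> \<bar>Z_lim \<sigma> k - Z \<sigma> n k\<bar> \<le> 2 / real (n + 1)"
  using Z_lim_pos(2) Z_lim_neg(2) by (auto simp: admissible_def sign_def)

lemma Z_bounded:
  assumes "admissible \<sigma> k"
  obtains C where "\<And>n. \<bar>Z \<sigma> n k\<bar> \<le> C"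
proof
  fix n
  have "2 / real (n + 1) \<le> 2" by (simp add: divide_simps)
  then show "\<bar>Z \<sigma> n k\<bar> \<le> \<bar>Z_lim \<sigma> k\<bar> + 2" using Z_error[OF assms, of n] by linarith
qed

section \<open>Power sums and linear sums as elements of the algebra\<close>

lemma euler_generator_intros:
  "k \<ge> 2 \<Longrightarrow> zeta_val k \<in> euler_algebra"
  "k \<ge> 1 \<Longrightarrow> alt_zeta_val k \<in> euler_algebra"
  "a \<ge> 1 \<Longrightarrow> b \<ge> 2 \<Longrightarrow> linear_sum zeta_part a b \<in> euler_algebra"
  "a \<ge> 1 \<Longrightarrow> b \<ge> 2 \<Longrightarrow> alt_linear_sum zeta_part a b \<in> euler_algebra"
  "a \<ge> 1 \<Longrightarrow> b \<ge> 2 \<Longrightarrow> linear_sum L_part a b \<in> euler_algebra"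
  "a \<ge> 1 \<Longrightarrow> b \<ge> 2 \<Longrightarrow> alt_linear_sum L_part a b \<in> euler_algebra"
  by (rule rat_poly_values_gen, unfold euler_generators_def Un_iff mem_Collect_eq, metis)+

lemma power_sum_sums:
  assumes "admissible \<tau> b"
  shows "(\<lambda>n. \<tau> ^ Suc n / real (Suc n) ^ b) sums Z_lim \<tau> b"
  using Z_tendsto[OF assms] unfolding sums_def Z_def One_nat_def sum.atLeast1_atMost_eq .

lemma Z_lim_in_algebra:
  assumes "admissible \<tau> b"
  shows "Z_lim \<tau> b \<in> euler_algebra"
proof (cases "\<tau> = 1")
  case True
  then have "Z_lim \<tau> b = zeta_val b"
    using power_sum_sums[OF assms] by (simp add: zeta_val_def sums_iff)
  then show ?thesis using assms True by (auto simp: admissible_def intro: euler_generator_intros)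
next
  case False
  then have t: "\<tau> = -1" using assms by (auto simp: admissible_def sign_def)
  have "(\<lambda>n. (-1) ^ n / real (Suc n) ^ b) sums - Z_lim \<tau> b"
    using sums_minus[OF power_sum_sums[OF assms]] t by simp
  then have "Z_lim \<tau> b = - alt_zeta_val b"
    by (simp add: alt_zeta_val_def sums_iff)
  then show ?thesis
    using assms t by (auto simp: admissible_def intro!: euler_generator_intros rat_poly_values_minus)
qed

lemma summable_in_algebra_power:
  "admissible \<tau> b \<Longrightarrow> summable_in_algebra (\<lambda>n. \<tau> ^ n / real n ^ b)"
  unfolding summable_in_algebra_def using power_sum_sums Z_lim_in_algebra by blast

text \<open>\<open>Z\<close> is bounded, so the series converges absolutely. The four choices of
  signs give the four kinds of generators, up to the sign in \<open>Z_neg\<close> and the one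
  between \<open>\<tau> ^ n\<close> and \<open>(-1) ^ (n - 1)\<close>.\<close>

lemma summable_in_algebra_linear_ge2:
  assumes "admissible \<sigma> a" "sign \<tau>" "b \<ge> 2"
  shows "summable_in_algebra (\<lambda>n. Z \<sigma> n a * \<tau> ^ n / real n ^ b)"
proof -
  obtain C where C: "\<And>n. \<bar>Z \<sigma> n a\<bar> \<le> C" using Z_bounded[OF assms(1)] by blast
  let ?f = "\<lambda>n. Z \<sigma> (Suc n) a * \<tau> ^ Suc n / real (Suc n) ^ b"
  have "admissible 1 b" using assms by (simp add: admissible_def)
  then have "summable (\<lambda>n. C * (1 / real (Suc n) ^ b))"
    using power_sum_sums[of 1 b] by (intro summable_mult) (simp add: sums_iff)
  then have sm: "summable ?f"
  proof (rule summable_comparison_test')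
    fix n :: nat
    show "norm (?f n) \<le> C * (1 / real (Suc n) ^ b)"
      using C[of "Suc n"] sign_abs_power[OF assms(2), of "Suc n"]
      by (simp add: abs_mult divide_right_mono del: power_Suc of_nat_Suc)
  qed
  have a: "a \<ge> 1" using assms by (simp add: admissible_def)
  have s: "?f sums suminf ?f" using sm by (rule summable_sums)
  consider "\<sigma> = 1" "\<tau> = 1" | "\<sigma> = 1" "\<tau> = -1" | "\<sigma> = -1" "\<tau> = 1" | "\<sigma> = -1" "\<tau> = -1"
    using assms by (auto simp: admissible_def sign_def)
  then have "suminf ?f \<in> euler_algebra"
  proof cases
    case 1
    then have "suminf ?f = linear_sum zeta_part a b" by (simp add: linear_sum_def Z_pos)
    then show ?thesis using a assms by (simp add: euler_generator_intros)
  next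
    case 2
    then have "(\<lambda>n. zeta_part (Suc n) a / real (Suc n) ^ b * (-1) ^ n) sums - suminf ?f"
      using sums_minus[OF s] by (simp add: Z_pos)
    then have "suminf ?f = - alt_linear_sum zeta_part a b" by (simp add: alt_linear_sum_def sums_iff)
    then show ?thesis using a assms by (simp add: euler_generator_intros rat_poly_values_minus)
  next
    case 3
    then have "(\<lambda>n. L_part (Suc n) a / real (Suc n) ^ b) sums - suminf ?f"
      using sums_minus[OF s] by (simp add: Z_neg)
    then have "suminf ?f = - linear_sum L_part a b" by (simp add: linear_sum_def sums_iff)
    then show ?thesis using a assms by (simp add: euler_generator_intros rat_poly_values_minus)
  next
    case 4
    then have "(\<lambda>n. L_part (Suc n) a / real (Suc n) ^ b * (-1) ^ n) sums suminf ?f"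
      using s by (simp add: Z_neg)
    then have "suminf ?f = alt_linear_sum L_part a b" by (simp add: alt_linear_sum_def sums_iff)
    then show ?thesis using a assms by (simp add: euler_generator_intros)
  qed
  then show ?thesis unfolding summable_in_algebra_def using s by blast
qed

text \<open>The product of two partial sums is a sum over a square, which is covered by two
  triangles meeting in the diagonal.\<close>

lemma Z_stuffle:
  "(\<Sum>n<N. Z \<sigma> (Suc n) a * \<tau> ^ Suc n / real (Suc n) ^ b) =
     Z \<sigma> N a * Z \<tau> N b + (\<Sum>n<N. (\<sigma> * \<tau>) ^ Suc n / real (Suc n) ^ (a + b))
      - (\<Sum>n<N. Z \<tau> (Suc n) b * \<sigma> ^ Suc n / real (Suc n) ^ a)"
proof (induction N)
  case (Suc N)
  define x where "x = \<sigma> ^ Suc N / real (Suc N) ^ a"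
  define y where "y = \<tau> ^ Suc N / real (Suc N) ^ b"
  have 1: "Z \<sigma> (Suc N) a * \<tau> ^ Suc N / real (Suc N) ^ b = (Z \<sigma> N a + x) * y"
    by (simp only: Z_Suc x_def y_def times_divide_eq_right)
  have 2: "Z \<tau> (Suc N) b * \<sigma> ^ Suc N / real (Suc N) ^ a = (Z \<tau> N b + y) * x"
    by (simp only: Z_Suc x_def y_def times_divide_eq_right)
  have 3: "(\<sigma> * \<tau>) ^ Suc N / real (Suc N) ^ (a + b) = x * y"
    by (simp only: x_def y_def times_divide_times_eq power_mult_distrib power_add)
  have 4: "Z \<sigma> (Suc N) a = Z \<sigma> N a + x" "Z \<tau> (Suc N) b = Z \<tau> N b + y"
    by (simp_all only: Z_Suc x_def y_def)
  show ?case
    unfolding sum.lessThan_Suc Suc.IH 1 2 3 unfolding 4 by (simp add: algebra_simps)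
qed simp

lemma summable_in_algebra_linear:
  assumes "sign \<sigma>" "a \<ge> 2" "admissible \<tau> b"
  shows "summable_in_algebra (\<lambda>n. Z \<sigma> n a * \<tau> ^ n / real n ^ b)"
proof (cases "b \<ge> 2")
  case True
  then show ?thesis using assms by (intro summable_in_algebra_linear_ge2) (auto simp: admissible_def)
next
  \<comment> \<open>Here \<open>b = 1\<close> and \<open>\<tau> = -1\<close>. Exchanging the two
    sums moves the exponent \<open>a \<ge> 2\<close> into the denominator.\<close>
  case False
  have adm: "admissible \<sigma> a" "admissible (\<sigma> * \<tau>) (a + b)" "sign \<tau>"
    using assms by (auto simp: admissible_def sign_mult)
  obtain x where x: "x \<in> euler_algebra" "(\<lambda>n. Z \<tau> (Suc n) b * \<sigma> ^ Suc n / real (Suc n) ^ a) sums x"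
    using summable_in_algebra_linear_ge2[OF assms(3,1,2)] unfolding summable_in_algebra_def by blast
  have "(\<lambda>N. Z \<sigma> N a * Z \<tau> N b + (\<Sum>n<N. (\<sigma> * \<tau>) ^ Suc n / real (Suc n) ^ (a + b))
      - (\<Sum>n<N. Z \<tau> (Suc n) b * \<sigma> ^ Suc n / real (Suc n) ^ a))
      \<longlonglongrightarrow> Z_lim \<sigma> a * Z_lim \<tau> b + Z_lim (\<sigma> * \<tau>) (a + b) - x"
    by (intro tendsto_intros Z_tendsto adm assms x(2)[unfolded sums_def]
          power_sum_sums[OF adm(2), unfolded sums_def])
  moreover have "Z_lim \<sigma> a * Z_lim \<tau> b + Z_lim (\<sigma> * \<tau>) (a + b) - x \<in> euler_algebra"
    using rat_poly_values_minus[OF x(1)] adm assms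
    by (metis Z_lim_in_algebra rat_poly_values_add rat_poly_values_mult diff_conv_add_uminus)
  ultimately show ?thesis
    unfolding summable_in_algebra_def sums_def by (auto simp only: Z_stuffle[of \<sigma> a \<tau> b, symmetric])
qed

section \<open>Partial fractions\<close>

text \<open>The recursion comes from \<open>1 / (x * y) = (1 / x - 1 / y) / (y - x)\<close>. For
  \<open>1 \<le> i \<le> p\<close> and \<open>q \<ge> 1\<close> the value is
  \<open>(-1) ^ (p - i)\<close> times the binomial coefficient of \<open>p + q - i - 1\<close> over
  \<open>q - 1\<close>.\<close>

fun pf_coeff :: "nat \<Rightarrow> nat \<Rightarrow> nat \<Rightarrow> int" where
  "pf_coeff p 0 i = (if i = p then 1 else 0)"
| "pf_coeff 0 (Suc q) i = 0"
| "pf_coeff (Suc p) (Suc q) i = pf_coeff (Suc p) q i - pf_coeff p (Suc q) i"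

lemma pf_coeff_eq_0: "i > p \<Longrightarrow> pf_coeff p q i = 0"
  by (induction p q i rule: pf_coeff.induct) auto

text \<open>The terms with a pole at \<open>x = 0\<close> in the expansion of
  \<open>1 / (x ^ p * y ^ q)\<close>, where \<open>d\<close> stands for \<open>y - x\<close>.
  Exchanging the roles gives those with a pole at \<open>y = 0\<close>.\<close>

definition pf_half :: "nat \<Rightarrow> nat \<Rightarrow> real \<Rightarrow> real \<Rightarrow> real" where
  "pf_half p q x d = (\<Sum>i=1..p. of_int (pf_coeff p q i) / (x ^ i * d ^ (p + q - i)))"

lemma pf_half_0: "p \<ge> 1 \<Longrightarrow> pf_half p 0 x d = 1 / x ^ p" "pf_half 0 q x d = 0"
proof -
  assume "p \<ge> 1"
  have "pf_half p 0 x d = (\<Sum>i=1..p. if i = p then 1 / x ^ p else 0)"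
    unfolding pf_half_def by (intro sum.cong) auto
  then show "pf_half p 0 x d = 1 / x ^ p" using \<open>p \<ge> 1\<close> by simp
qed (simp add: pf_half_def)

lemma pf_half_Suc:
  assumes "d \<noteq> 0"
  shows "pf_half (Suc p) (Suc q) x d = (pf_half (Suc p) q x d - pf_half p (Suc q) x d) / d"
proof -
  \<comment> \<open>The extra summand \<open>i = Suc p\<close> is 0; it puts both sums over the same
    range.\<close>
  have "pf_half p (Suc q) x d = (\<Sum>i=1..Suc p. of_int (pf_coeff p (Suc q) i) / (x ^ i * d ^ (p + Suc q - i)))"
    by (simp add: pf_half_def pf_coeff_eq_0)
  moreover have "d ^ (Suc p + Suc q - i) = d * d ^ (Suc p + q - i)" if "i \<le> Suc p" for i
    using that by (simp add: Suc_diff_le flip: power_Suc)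
  ultimately show ?thesis
    unfolding pf_half_def
    by (simp only: sum_divide_distrib flip: sum_subtractf)
       (intro sum.cong refl, simp add: diff_divide_distrib mult_ac)
qed

lemma partial_fractions_two:
  fixes x y :: real
  assumes "x \<noteq> 0" "y \<noteq> 0" "x \<noteq> y" "p + q \<ge> 1"
  shows "1 / (x ^ p * y ^ q) = pf_half p q x (y - x) + pf_half q p y (x - y)"
  using assms(4)
proof (induction "p + q" arbitrary: p q)
  case (Suc n)
  show ?case
  proof (cases "p = 0 \<or> q = 0")
    case True
    then show ?thesis using Suc.prems by (auto simp: pf_half_0)
  next
    case False
    then obtain p' q' where pq: "p = Suc p'" "q = Suc q'" by (metis not0_implies_Suc)
    have "1 / (x ^ p * y ^ q) = (1 / (x ^ p * y ^ q') - 1 / (x ^ p' * y ^ q)) / (y - x)"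
      using assms(1-3) by (simp add: pq divide_simps) (simp add: algebra_simps)?
    also have "1 / (x ^ p * y ^ q') = pf_half p q' x (y - x) + pf_half q' p y (x - y)"
      using Suc.hyps(2) pq by (intro Suc.hyps(1)) auto
    also have "1 / (x ^ p' * y ^ q) = pf_half p' q x (y - x) + pf_half q p' y (x - y)"
      using Suc.hyps(2) pq by (intro Suc.hyps(1)) auto
    \<comment> \<open>The terms with poles in \<open>x\<close> are divided by \<open>y - x\<close>,
      those with poles in \<open>y\<close> by \<open>x - y\<close>, so that both match the recursion
      for \<open>pf_half\<close>.\<close>
    also have "(pf_half p q' x (y - x) + pf_half q' p y (x - y) -
          (pf_half p' q x (y - x) + pf_half q p' y (x - y))) / (y - x)
        = (pf_half p q' x (y - x) - pf_half p' q x (y - x)) / (y - x)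
          + (pf_half q p' y (x - y) - pf_half q' p y (x - y)) / (x - y)"
      using assms(3) by (simp add: divide_simps) (simp add: algebra_simps)?
    also have "\<dots> = pf_half p q x (y - x) + pf_half q p y (x - y)"
      using assms(3) by (simp add: pq pf_half_Suc)
    finally show ?thesis .
  qed
qed simp

text \<open>This iterates \<open>1 / (x * y) = (1 / x + 1 / y) / (x + y)\<close>. It is meant for
  \<open>x = n\<close> and \<open>y = j - n\<close>, where \<open>x + y = j\<close> is free of
  \<open>n\<close>.\<close>

lemma partial_fractions_pole_1:
  fixes x y :: real
  assumes "x \<noteq> 0" "y \<noteq> 0" "x + y \<noteq> 0"
  shows "1 / (x * y ^ i) = 1 / ((x + y) ^ i * x) + (\<Sum>t=1..i. 1 / ((x + y) ^ (i + 1 - t) * y ^ t))"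
proof (induction i)
  case (Suc i)
  have "1 / (x * y ^ Suc i) = 1 / (x * y ^ i) / y" by simp
  also have "\<dots> = 1 / ((x + y) ^ i * x * y) + (\<Sum>t=1..i. 1 / ((x + y) ^ (Suc i + 1 - Suc t) * y ^ Suc t))"
    unfolding Suc.IH by (simp add: add_divide_distrib sum_divide_distrib mult_ac)
  also have "1 / ((x + y) ^ i * x * y) = 1 / ((x + y) ^ Suc i * x) + 1 / ((x + y) ^ (Suc i + 1 - 1) * y ^ 1)"
    using assms by (simp add: divide_simps)
  also have "(\<Sum>t=1..i. 1 / ((x + y) ^ (Suc i + 1 - Suc t) * y ^ Suc t))
      = (\<Sum>t=Suc 1..Suc i. 1 / ((x + y) ^ (Suc i + 1 - t) * y ^ t))"
    by (rule sum.shift_bounds_cl_Suc_ivl[symmetric])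
  finally show ?case
    by (simp add: sum.atLeast_Suc_atMost[of "Suc 0" "Suc i"] del: sum.cl_ivl_Suc)
qed (use assms in simp)

section \<open>Finite bilateral sums\<close>

text \<open>As \<open>j + n\<close> and \<open>j - n\<close> have the same parity, for
  \<open>\<sigma>\<close> equal to 1 or -1 the sign is that of the index
  \<open>j - n\<close>.\<close>

definition U :: "real \<Rightarrow> nat \<Rightarrow> nat \<Rightarrow> int \<Rightarrow> real" where
  "U \<sigma> M k n = (\<Sum>j\<in>{1..int M} - {n}. \<sigma> powi (j + n) / of_int (j - n) ^ k)"

lemma sign_powi_add: "sign \<sigma> \<Longrightarrow> \<sigma> powi (m + n) = \<sigma> powi m * \<sigma> powi n"
  by (rule power_int_add) (auto simp: sign_def)

lemma sign_powi_square: "sign \<sigma> \<Longrightarrow> \<sigma> powi m * \<sigma> powi m = 1"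
  by (simp add: sign_def) (auto simp flip: power_int_mult_distrib)

lemma sign_powi_uminus: "sign \<sigma> \<Longrightarrow> \<sigma> powi (- m) = \<sigma> powi m"
  by (auto simp: sign_def power_int_minus simp flip: power_int_inverse)

lemma sign_powi_diff: "sign \<sigma> \<Longrightarrow> \<sigma> powi (m - n) = \<sigma> powi (m + n)"
  using sign_powi_add[of \<sigma> m "- n"] by (simp add: sign_powi_add sign_powi_uminus)

text \<open>The \<open>j\<close> above \<open>n\<close> give the differences
  \<open>1, ..., M - n\<close>; those below give \<open>-1, ..., -(n - 1)\<close> and hence the
  factor \<open>(-1) ^ k\<close>.\<close>

lemma U_pos:
  assumes "sign \<sigma>" "1 \<le> n" "n \<le> M"
  shows "U \<sigma> M k (int n) = Z \<sigma> (M - n) k + (-1) ^ k * Z \<sigma> (n - 1) k"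
proof -
  have "{1..int M} - {int n} = {int n + 1..int M} \<union> {1..int n - 1}"
    using assms by auto
  then have "U \<sigma> M k (int n) = (\<Sum>j\<in>{int n + 1..int M}. \<sigma> powi (j + n) / of_int (j - n) ^ k)
      + (\<Sum>j\<in>{1..int n - 1}. \<sigma> powi (j + n) / of_int (j - n) ^ k)"
    unfolding U_def by (simp add: sum.union_disjoint)
  also have "(\<Sum>j\<in>{int n + 1..int M}. \<sigma> powi (j + n) / of_int (j - n) ^ k) = Z \<sigma> (M - n) k"
    unfolding Z_def
  proof (rule sum.reindex_bij_witness[of _ "\<lambda>m. int n + int m" "\<lambda>j. nat (j - int n)"])
    fix j assume "j \<in> {int n + 1..int M}"
    moreover from this have "\<sigma> powi (j + int n) = \<sigma> ^ nat (j - int n)"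
      using sign_powi_diff[OF assms(1), of j n] by (simp add: power_int_def)
    ultimately show "\<sigma> ^ nat (j - int n) / real (nat (j - int n)) ^ k = \<sigma> powi (j + int n) / real_of_int (j - int n) ^ k"
      by simp
  qed (use assms in auto)
  also have "(\<Sum>j\<in>{1..int n - 1}. \<sigma> powi (j + n) / of_int (j - n) ^ k) = (-1) ^ k * Z \<sigma> (n - 1) k"
    unfolding Z_def sum_distrib_left
  proof (rule sum.reindex_bij_witness[of _ "\<lambda>m. int n - int m" "\<lambda>j. nat (int n - j)"])
    fix j assume j: "j \<in> {1..int n - 1}"
    have "\<sigma> powi (j + int n) = \<sigma> ^ nat (int n - j)"
      using sign_powi_diff[OF assms(1), of n j] j by (simp add: add.commute power_int_def)
    moreover have "real_of_int (j - int n) ^ k = (-1) ^ k * real (nat (int n - j)) ^ k"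
      using j by (simp flip: power_mult_distrib)
    ultimately show "(- 1) ^ k * (\<sigma> ^ nat (int n - j) / real (nat (int n - j)) ^ k) = \<sigma> powi (j + int n) / real_of_int (j - int n) ^ k"
      by (simp add: divide_simps) (simp flip: power_mult_distrib)?
  qed (use assms in auto)
  finally show ?thesis .
qed

lemma U_neg:
  assumes "sign \<sigma>"
  shows "U \<sigma> M k (- int n) = Z \<sigma> (M + n) k - Z \<sigma> n k"
proof -
  have "U \<sigma> M k (- int n) = (\<Sum>m\<in>{n+1..M+n}. \<sigma> ^ m / real m ^ k)"
    unfolding U_def
  proof (rule sum.reindex_bij_witness[of _ "\<lambda>m. int m - int n" "\<lambda>j. nat (j + int n)"])
    fix j assume j: "j \<in> {1..int M} - {- int n}"
    have "\<sigma> powi (j + - int n) = \<sigma> ^ nat (j + int n)"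
      using sign_powi_diff[OF assms(1), of j n] j by (simp add: power_int_def)
    then show "\<sigma> ^ nat (j + int n) / real (nat (j + int n)) ^ k = \<sigma> powi (j + - int n) / real_of_int (j - - int n) ^ k"
      using j by simp
  qed auto
  also have "\<dots> = Z \<sigma> (M + n) k - Z \<sigma> n k"
  proof -
    have "{1..M+n} = {1..n} \<union> {n+1..M+n}" by auto
    then show ?thesis unfolding Z_def by (simp add: sum.union_disjoint)
  qed
  finally show ?thesis .
qed

lemma U_without:
  assumes "j \<noteq> n"
  shows "(\<Sum>k\<in>{1..int M} - {n} - {j}. \<sigma> powi (j + k) / of_int (k - j) ^ l)
    = U \<sigma> M l j - (if n \<in> {1..int M} then \<sigma> powi (j + n) / of_int (n - j) ^ l else 0)"
proof (cases "n \<in> {1..int M}")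
  case True
  have "{1..int M} - {n} - {j} = {1..int M} - {j} - {n}" by auto
  then show ?thesis
    using True assms by (simp add: U_def sum_diff1 add.commute)
next
  case False
  then have "{1..int M} - {n} = {1..int M}" by auto
  then show ?thesis using False by (simp only: U_def if_False add.commute diff_zero)
qed

text \<open>Collects the terms \<open>k = n\<close>, which the product \<open>U p n * U q n\<close> lacks but \<open>U (p+q-i) j\<close> contains.\<close>

definition kappa :: "nat \<Rightarrow> nat \<Rightarrow> real" where
  "kappa p q = (\<Sum>i=1..p. of_int (pf_coeff p q i) * (-1) ^ (p + q - i))"

text \<open>Summing over \<open>k\<close> first turns each partial fraction into \<open>U\<close> at
  \<open>j\<close>, short of the term \<open>k = n\<close>. That term has denominator
  \<open>(j - n) ^ i * (n - j) ^ (p + q - i)\<close>, so these terms add up to a multiple of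
  \<open>U \<sigma> M (p + q) n\<close>.\<close>

lemma sum_pf_half:
  assumes "sign \<sigma>"
  shows "(\<Sum>j\<in>{1..int M} - {n}. \<Sum>k\<in>{1..int M} - {n} - {j}.
       \<sigma> powi (j + k) * pf_half p q (of_int (j - n)) (of_int (k - j)))
    = (\<Sum>i=1..p. of_int (pf_coeff p q i) *
         (\<Sum>j\<in>{1..int M} - {n}. U \<sigma> M (p + q - i) j / of_int (j - n) ^ i))
      - (if n \<in> {1..int M} then kappa p q * U \<sigma> M (p + q) n else 0)"
    (is "?lhs = ?rhs")
proof -
  let ?A = "{1..int M} - {n}"
  let ?c = "\<lambda>i. of_int (pf_coeff p q i) :: real"
  let ?\<epsilon> = "if n \<in> {1..int M} then 1 else 0 :: real"
  have "?lhs = (\<Sum>j\<in>?A. \<Sum>i=1..p. ?c i / of_int (j - n) ^ i *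
            (\<Sum>k\<in>?A - {j}. \<sigma> powi (j + k) / of_int (k - j) ^ (p + q - i)))"
    unfolding pf_half_def sum_distrib_left
    by (intro sum.cong refl, subst sum.swap) (simp add: mult_ac)
  also have "\<dots> = (\<Sum>j\<in>?A. \<Sum>i=1..p. ?c i * (U \<sigma> M (p + q - i) j / of_int (j - n) ^ i)
            - ?\<epsilon> * (?c i * (-1) ^ (p + q - i)) * (\<sigma> powi (j + n) / of_int (j - n) ^ (p + q)))"
  proof (intro sum.cong refl)
    fix j i assume j: "j \<in> ?A" and i: "i \<in> {1..p}"
    have "p + q = i + (p + q - i)" using i by simp
    then have "(of_int (j - n) :: real) ^ (p + q) = of_int (j - n) ^ i * of_int (j - n) ^ (p + q - i)"
      by (metis power_add)
    moreover have "(of_int (n - j) :: real) ^ (p + q - i) = (-1) ^ (p + q - i) * of_int (j - n) ^ (p + q - i)"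
      by (simp flip: power_mult_distrib)
    moreover have "(of_int (j - n) :: real) \<noteq> 0" using j by simp
    ultimately show "?c i / of_int (j - n) ^ i * (\<Sum>k\<in>?A - {j}. \<sigma> powi (j + k) / of_int (k - j) ^ (p + q - i))
       = ?c i * (U \<sigma> M (p + q - i) j / of_int (j - n) ^ i)
            - ?\<epsilon> * (?c i * (-1) ^ (p + q - i)) * (\<sigma> powi (j + n) / of_int (j - n) ^ (p + q))"
      using j by (subst U_without; cases "even (p + q - i)")
        (simp_all add: right_diff_distrib divide_simps del: of_int_diff)
  qed
  also have "\<dots> = (\<Sum>i=1..p. ?c i * (\<Sum>j\<in>?A. U \<sigma> M (p + q - i) j / of_int (j - n) ^ i))
      - ?\<epsilon> * (kappa p q * U \<sigma> M (p + q) n)"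
    unfolding sum_subtractf kappa_def U_def sum_product
    by (intro arg_cong2[of _ _ _ _ "(-)"])
       (subst sum.swap, simp add: sum_distrib_left mult_ac)+
  finally show ?thesis by simp
qed

lemma sum_offdiag_swap:
  fixes f :: "'i \<Rightarrow> 'i \<Rightarrow> real"
  assumes "finite A"
  shows "(\<Sum>j\<in>A. \<Sum>k\<in>A - {j}. f j k) = (\<Sum>j\<in>A. \<Sum>k\<in>A - {j}. f k j)"
proof -
  have "(\<Sum>j\<in>A. \<Sum>k\<in>A - {j}. g j k) = (\<Sum>j\<in>A. \<Sum>k\<in>A. g j k) - (\<Sum>j\<in>A. g j j)" for g :: "'i \<Rightarrow> 'i \<Rightarrow> real"
    using assms by (simp add: sum_diff1 sum_subtractf)
  from this[of f] this[of "\<lambda>j k. f k j"] show ?thesis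
    by (simp add: sum.swap[of "\<lambda>j k. f k j"])
qed

text \<open>The diagonal \<open>j = k\<close> gives \<open>U 1\<close>, as signs square to 1. Off
  the diagonal, partial fractions apply to \<open>j - n\<close> and \<open>k - n\<close>, whose
  difference is free of \<open>n\<close>; the second half takes the shape of the first once
  \<open>j\<close> and \<open>k\<close> are exchanged.\<close>

lemma U_mult:
  assumes "sign \<sigma>" "p + q \<ge> 1"
  shows "U \<sigma> M p n * U \<sigma> M q n = U 1 M (p + q) n
     + (\<Sum>i=1..p. of_int (pf_coeff p q i) *
         (\<Sum>j\<in>{1..int M} - {n}. U \<sigma> M (p + q - i) j / of_int (j - n) ^ i))
     + (\<Sum>i=1..q. of_int (pf_coeff q p i) *
         (\<Sum>j\<in>{1..int M} - {n}. U \<sigma> M (p + q - i) j / of_int (j - n) ^ i))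
     - (if n \<in> {1..int M} then (kappa p q + kappa q p) * U \<sigma> M (p + q) n else 0)"
proof -
  let ?A = "{1..int M} - {n}"
  let ?f = "\<lambda>j k. \<sigma> powi (j + n) / of_int (j - n) ^ p * (\<sigma> powi (k + n) / of_int (k - n) ^ q)"
  let ?h = "\<lambda>p q j k. \<sigma> powi (j + k) * pf_half p q (of_int (j - n)) (of_int (k - j))"
  have "U \<sigma> M p n * U \<sigma> M q n = (\<Sum>j\<in>?A. \<Sum>k\<in>?A. ?f j k)"
    unfolding U_def sum_product ..
  also have "\<dots> = (\<Sum>j\<in>?A. ?f j j + (\<Sum>k\<in>?A - {j}. ?f j k))"
    by (intro sum.cong refl sum.remove) auto
  also have "\<dots> = U 1 M (p + q) n + (\<Sum>j\<in>?A. \<Sum>k\<in>?A - {j}. ?f j k)"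
    unfolding U_def sum.distrib
    by (intro arg_cong2[of _ _ _ _ "(+)"] refl sum.cong) (simp add: sign_powi_square[OF assms(1)] power_add)
  also have "(\<Sum>j\<in>?A. \<Sum>k\<in>?A - {j}. ?f j k) = (\<Sum>j\<in>?A. \<Sum>k\<in>?A - {j}. ?h p q j k + ?h q p k j)"
  proof (intro sum.cong refl)
    fix j k assume jk: "j \<in> ?A" "k \<in> ?A - {j}"
    \<comment> \<open>The sign belonging to \<open>n\<close> occurs twice and drops out.\<close>
    have "\<sigma> powi (j + n) * \<sigma> powi (k + n) = \<sigma> powi (j + k)"
      using sign_powi_square[OF assms(1), of n] by (simp add: sign_powi_add[OF assms(1)])
    then have "?f j k = \<sigma> powi (j + k) * (1 / (of_int (j - n) ^ p * of_int (k - n) ^ q))"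
      by (simp flip: times_divide_times_eq)
    also have "1 / (of_int (j - n) ^ p * of_int (k - n) ^ q)
        = pf_half p q (of_int (j - n)) (of_int (k - n) - of_int (j - n))
          + pf_half q p (of_int (k - n)) (of_int (j - n) - of_int (k - n))"
      using jk assms(2) by (intro partial_fractions_two) auto
    finally show "?f j k = ?h p q j k + ?h q p k j"
      by (simp add: distrib_left add.commute)
  qed
  also have "\<dots> = (\<Sum>j\<in>?A. \<Sum>k\<in>?A - {j}. ?h p q j k) + (\<Sum>j\<in>?A. \<Sum>k\<in>?A - {j}. ?h q p j k)"
    unfolding sum.distrib by (subst (2) sum_offdiag_swap) auto
  finally show ?thesis
    unfolding sum_pf_half[OF assms(1)] by (simp add: add.commute distrib_right)
qed

text \<open>\<open>W M i j / j\<close> is the sum of \<open>(-1) ^ n / (n * (j - n) ^ i)\<close>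
  over \<open>\<bar>n\<bar> \<le> M\<close> without \<open>n = 0\<close> and \<open>n = j\<close>.
  The factor \<open>1 / j\<close> is kept apart as the weight of the outer sum.\<close>

definition W :: "nat \<Rightarrow> nat \<Rightarrow> nat \<Rightarrow> real" where
  "W M i j = - ((-1) ^ j + real i) / real j ^ i
     + (-1) ^ j * (\<Sum>t=1..i. (Z (-1) (M + j) t + (-1) ^ t * Z (-1) (M - j) t) / real j ^ (i - t))"

text \<open>The summand is odd in \<open>n\<close>.\<close>

lemma bilateral_alternating_harmonic:
  "(\<Sum>n\<in>{- int M..int M} - {0}. (-1) powi n / of_int n) = (0::real)"
proof -
  have "(\<Sum>n\<in>{- int M..int M} - {0}. (-1) powi n / of_int n)
      = (\<Sum>n\<in>{- int M..int M} - {0}. - ((-1) powi n / of_int n) :: real)"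
    by (rule sum.reindex_bij_witness[of _ uminus uminus]) (auto simp: sign_powi_uminus)
  then show ?thesis by (simp add: sum_negf)
qed

lemma bilateral_alternating_shifted:
  assumes "1 \<le> j" "j \<le> M"
  shows "(\<Sum>n\<in>{- int M..int M} - {int j}. (-1) powi n / of_int (int j - n) ^ t)
    = (-1) ^ j * (Z (-1) (M + j) t + (-1) ^ t * Z (-1) (M - j) t)"
proof -
  \<comment> \<open>Shifting by \<open>M + 1\<close> maps the symmetric range onto
    \<open>1, ..., 2 * M + 1\<close> and \<open>j\<close> to \<open>j + M + 1\<close>, where
    \<open>U_pos\<close> applies; reversing \<open>j - n\<close> costs
    \<open>(-1) ^ t\<close>.\<close>
  have "U (-1) (2 * M + 1) t (int (j + M + 1))
      = (\<Sum>n\<in>{- int M..int M} - {int j}. (-1) ^ (j + t) * ((-1) powi n / of_int (int j - n) ^ t))"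
    unfolding U_def
  proof (rule sum.reindex_bij_witness[of _ "\<lambda>n. n + int M + 1" "\<lambda>n. n - int M - 1"])
    fix n assume n: "n \<in> {1..int (2 * M + 1)} - {int (j + M + 1)}"
    have "(-1 :: real) powi (n + int (j + M + 1)) = (-1) powi (n - int (j + M + 1))"
      by (simp only: sign_powi_diff sign_simps)
    also have "n - int (j + M + 1) = (n - int M - 1) - int j" by simp
    also have "(-1 :: real) powi \<dots> = (-1) ^ j * (-1) powi (n - int M - 1)"
      by (simp only: sign_powi_diff sign_powi_add sign_simps power_int_of_nat mult.commute)
    finally have 1: "(-1 :: real) powi (n + int (j + M + 1)) = (-1) ^ j * (-1) powi (n - int M - 1)" .
    have 2: "real_of_int (n - int (j + M + 1)) ^ t = (-1) ^ t * of_int (int j - (n - int M - 1)) ^ t"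
      by (subst power_mult_distrib[symmetric], rule arg_cong[of _ _ "\<lambda>x. x ^ t"]) simp
    show "(-1) ^ (j + t) * ((-1) powi (n - int M - 1) / of_int (int j - (n - int M - 1)) ^ t)
        = (-1) powi (n + int (j + M + 1)) / real_of_int (n - int (j + M + 1)) ^ t"
      unfolding 1 2 by (cases "even t") (simp_all add: power_add)
  qed auto
  then have "(-1) ^ (j + t) * (\<Sum>n\<in>{- int M..int M} - {int j}. (-1) powi n / of_int (int j - n) ^ t)
      = Z (-1) (M - j) t + (-1) ^ t * Z (-1) (M + j) t"
    using U_pos[of "-1" "j + M + 1" "2 * M + 1" t] assms by (simp add: sum_distrib_left add.commute)
  then show ?thesis
    by (cases "even t"; cases "even j") (simp_all add: power_add algebra_simps)
qed

lemma bilateral_kernel: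
  assumes "1 \<le> j" "j \<le> M" "i \<ge> 1"
  shows "(\<Sum>n\<in>{- int M..int M} - {0} - {int j}. (-1) powi n / of_int n / of_int (int j - n) ^ i)
     = W M i j / real j"
proof -
  let ?I = "{- int M..int M} - {0} - {int j}"
  \<comment> \<open>The shifted sum also contains \<open>n = 0\<close>, whose term
    \<open>1 / j ^ t\<close> is removed.\<close>
  have S: "(\<Sum>n\<in>?I. (-1) powi n / of_int (int j - n) ^ t)
      = (-1) ^ j * (Z (-1) (M + j) t + (-1) ^ t * Z (-1) (M - j) t) - 1 / real j ^ t" for t
  proof -
    have "?I = {- int M..int M} - {int j} - {0}" by auto
    then have "(\<Sum>n\<in>?I. (-1) powi n / of_int (int j - n) ^ t)
        = (\<Sum>n\<in>{- int M..int M} - {int j}. (-1) powi n / of_int (int j - n) ^ t) - 1 / real j ^ t"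
      using assms by (simp only:) (subst sum_diff1, auto)
    then show ?thesis by (simp only: bilateral_alternating_shifted[OF assms(1,2)])
  qed
  have "(\<Sum>n\<in>?I. (-1) powi n / of_int n / of_int (int j - n) ^ i)
     = (\<Sum>n\<in>?I. ((-1) powi n / of_int n) / real j ^ i
          + (\<Sum>t=1..i. ((-1) powi n / of_int (int j - n) ^ t) / real j ^ (i + 1 - t)))"
  proof (intro sum.cong refl)
    fix n assume n: "n \<in> ?I"
    have "1 / (real_of_int n * of_int (int j - n) ^ i) = 1 / (real j ^ i * of_int n)
        + (\<Sum>t=1..i. 1 / (real j ^ (i + 1 - t) * of_int (int j - n) ^ t))"
      using partial_fractions_pole_1[of "of_int n" "of_int (int j - n)" i] n assms by simp
    then have "(-1) powi n * (1 / (real_of_int n * of_int (int j - n) ^ i)) = (-1) powi n * (1 / (real j ^ i * of_int n)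
        + (\<Sum>t=1..i. 1 / (real j ^ (i + 1 - t) * of_int (int j - n) ^ t)))"
      by simp
    then show "(-1) powi n / of_int n / of_int (int j - n) ^ i
       = ((-1) powi n / of_int n) / real j ^ i
          + (\<Sum>t=1..i. ((-1) powi n / of_int (int j - n) ^ t) / real j ^ (i + 1 - t))"
      by (simp add: distrib_left sum_distrib_left mult_ac)
  qed
  also have "\<dots> = (\<Sum>n\<in>?I. (-1) powi n / of_int n) / real j ^ i
      + (\<Sum>t=1..i. (\<Sum>n\<in>?I. (-1) powi n / of_int (int j - n) ^ t) / real j ^ (i + 1 - t))"
    unfolding sum.distrib sum_divide_distrib by (subst sum.swap) simp
  \<comment> \<open>The sum over all \<open>n \<noteq> 0\<close> vanishes, which leaves minus the
    term \<open>n = j\<close>.\<close>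
  also have "(\<Sum>n\<in>?I. (-1) powi n / of_int n) = - ((-1) ^ j / real j)"
    using assms by (subst sum_diff1) (auto simp: bilateral_alternating_harmonic)
  \<comment> \<open>Each of the \<open>i\<close> summands contributes \<open>- 1 / j ^ i\<close>,
    which makes up the \<open>real i\<close> in \<open>W\<close>.\<close>
  also have "(\<Sum>t=1..i. (\<Sum>n\<in>?I. (-1) powi n / of_int (int j - n) ^ t) / real j ^ (i + 1 - t))
     = (\<Sum>t=1..i. ((-1) ^ j * ((Z (-1) (M + j) t + (-1) ^ t * Z (-1) (M - j) t) / real j ^ (i - t)) - 1 / real j ^ i) / real j)"
  unfolding S
  proof (intro sum.cong refl)
    fix t assume "t \<in> {1..i}"
    then have "i + 1 - t = Suc (i - t)" "i = t + (i - t)" by auto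
    then have "real j ^ (i + 1 - t) = real j * real j ^ (i - t)" "real j ^ i = real j ^ t * real j ^ (i - t)"
      by (simp, metis power_add)
    then show "((-1) ^ j * (Z (-1) (M + j) t + (-1) ^ t * Z (-1) (M - j) t) - 1 / real j ^ t) / real j ^ (i + 1 - t)
       = ((-1) ^ j * ((Z (-1) (M + j) t + (-1) ^ t * Z (-1) (M - j) t) / real j ^ (i - t)) - 1 / real j ^ i) / real j"
      using assms by (simp add: field_simps)
  qed
  also have "- ((-1) ^ j / real j) / real j ^ i + \<dots> = W M i j / real j"
    unfolding W_def
    by (simp add: sum_subtractf add_divide_distrib diff_divide_distrib mult_ac flip: sum_divide_distrib sum_distrib_left)
  finally show ?thesis .
qed

lemma sum_nat_int: "(\<Sum>j\<in>{1..int M}. f j) = (\<Sum>j=1..M. f (int j))"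
  by (rule sum.reindex_bij_witness[of _ int nat]) auto

lemma sum_int_nonzero:
  "(\<Sum>n\<in>{- int M..int M} - {0}. f n) = (\<Sum>n=1..M. f (int n) + f (- int n) :: real)"
proof -
  have "{- int M..int M} - {0} = {1..int M} \<union> {- int M..-1}" by auto
  then have "(\<Sum>n\<in>{- int M..int M} - {0}. f n) = (\<Sum>n\<in>{1..int M}. f n) + (\<Sum>n\<in>{- int M..-1}. f n)"
    by (simp add: sum.union_disjoint)
  also have "(\<Sum>n\<in>{- int M..-1}. f n) = (\<Sum>n\<in>{1..int M}. f (- n))"
    by (rule sum.reindex_bij_witness[of _ uminus uminus]) auto
  finally show ?thesis by (simp add: sum_nat_int sum.distrib)
qed

text \<open>After the exchange of sums, the inner sum over \<open>n\<close> no longer involves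
  \<open>g\<close> and is the one in \<open>bilateral_kernel\<close>.\<close>

lemma sum_bilateral_kernel:
  assumes "i \<ge> 1"
  shows "(\<Sum>n\<in>{- int M..int M} - {0}. (-1) powi n / of_int n * (\<Sum>j\<in>{1..int M} - {n}. g j / of_int (j - n) ^ i))
    = (\<Sum>j=1..M. g (int j) * W M i j / real j)"
proof -
  let ?I = "{- int M..int M} - {0}"
  have "(\<Sum>n\<in>?I. (-1) powi n / of_int n * (\<Sum>j\<in>{1..int M} - {n}. g j / of_int (j - n) ^ i))
      = (\<Sum>n\<in>?I. \<Sum>j | j \<in> {1..int M} \<and> j \<noteq> n. g j * ((-1) powi n / of_int n / of_int (j - n) ^ i))"
    unfolding sum_distrib_left by (intro sum.cong) (auto simp: mult_ac)
  also have "\<dots> = (\<Sum>j\<in>{1..int M}. \<Sum>n | n \<in> ?I \<and> j \<noteq> n. g j * ((-1) powi n / of_int n / of_int (j - n) ^ i))"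
    by (rule sum.swap_restrict) auto
  also have "\<dots> = (\<Sum>j\<in>{1..int M}. g j * (\<Sum>n\<in>?I - {j}. (-1) powi n / of_int n / of_int (j - n) ^ i))"
    unfolding sum_distrib_left by (intro sum.cong refl) auto
  also have "\<dots> = (\<Sum>j=1..M. g (int j) * (W M i j / real j))"
    unfolding sum_nat_int using assms by (intro sum.cong refl, subst bilateral_kernel) auto
  finally show ?thesis by simp
qed

text \<open>The share of \<open>n\<close> in the difference of the two evaluations of the bilateral
  sum, multiplied by \<open>n\<close>. The minus sign inside the first product term comes from
  \<open>1 / (- n)\<close>; single values need not vanish.\<close>

definition defect :: "real \<Rightarrow> nat \<Rightarrow> nat \<Rightarrow> nat \<Rightarrow> nat \<Rightarrow> real" where
  "defect \<sigma> p q M n =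
     (-1) ^ n * (U \<sigma> M p (int n) * U \<sigma> M q (int n) - U \<sigma> M p (- int n) * U \<sigma> M q (- int n))
     - W M (p + q) n
     - (\<Sum>i=1..p. of_int (pf_coeff p q i) * (U \<sigma> M (p + q - i) (int n) * W M i n))
     - (\<Sum>i=1..q. of_int (pf_coeff q p i) * (U \<sigma> M (p + q - i) (int n) * W M i n))
     + (kappa p q + kappa q p) * ((-1) ^ n * U \<sigma> M (p + q) (int n))"

lemma sum_defect:
  assumes "sign \<sigma>" "p + q \<ge> 1"
  shows "(\<Sum>n=1..M. defect \<sigma> p q M n / real n) = 0"
proof -
  let ?I = "{- int M..int M} - {0}"
  let ?w = "\<lambda>n. (-1) powi n / real_of_int n"
  let ?A = "\<lambda>n. {1..int M} - {n}"
  have "(\<Sum>n\<in>?I. ?w n * (U \<sigma> M p n * U \<sigma> M q n))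
      = (\<Sum>n\<in>?I. ?w n * (\<Sum>j\<in>?A n. 1 / of_int (j - n) ^ (p + q))
          + (\<Sum>i=1..p. of_int (pf_coeff p q i) * (?w n * (\<Sum>j\<in>?A n. U \<sigma> M (p + q - i) j / of_int (j - n) ^ i)))
          + (\<Sum>i=1..q. of_int (pf_coeff q p i) * (?w n * (\<Sum>j\<in>?A n. U \<sigma> M (p + q - i) j / of_int (j - n) ^ i)))
          - (if n \<in> {1..int M} then (kappa p q + kappa q p) * (?w n * U \<sigma> M (p + q) n) else 0))"
    unfolding U_mult[OF assms] U_def[of 1]
    by (intro sum.cong refl) (simp add: algebra_simps sum_distrib_left)
  also have "\<dots> = (\<Sum>n\<in>?I. ?w n * (\<Sum>j\<in>?A n. 1 / of_int (j - n) ^ (p + q)))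
          + (\<Sum>i=1..p. of_int (pf_coeff p q i) * (\<Sum>n\<in>?I. ?w n * (\<Sum>j\<in>?A n. U \<sigma> M (p + q - i) j / of_int (j - n) ^ i)))
          + (\<Sum>i=1..q. of_int (pf_coeff q p i) * (\<Sum>n\<in>?I. ?w n * (\<Sum>j\<in>?A n. U \<sigma> M (p + q - i) j / of_int (j - n) ^ i)))
          - (\<Sum>n\<in>?I. if n \<in> {1..int M} then (kappa p q + kappa q p) * (?w n * U \<sigma> M (p + q) n) else 0)"
    unfolding sum.distrib sum_subtractf sum_distrib_left[of "of_int _"]
    by (subst (1 2) sum.swap[of _ _ ?I]) simp
  \<comment> \<open>Only positive \<open>n\<close> lie in \<open>{1..int M}\<close>, so the partners
    \<open>-n\<close> drop out.\<close>
  also have "(\<Sum>n\<in>?I. if n \<in> {1..int M} then (kappa p q + kappa q p) * (?w n * U \<sigma> M (p + q) n) else 0)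
      = (\<Sum>n=1..M. (kappa p q + kappa q p) * ((-1) ^ n / real n * U \<sigma> M (p + q) (int n)))"
    unfolding sum_int_nonzero by (intro sum.cong refl) auto
  \<comment> \<open>The diagonal term \<open>U 1\<close> is the kernel sum with constant weight
    1.\<close>
  also have "(\<Sum>n\<in>?I. ?w n * (\<Sum>j\<in>?A n. 1 / of_int (j - n) ^ (p + q))) = (\<Sum>j=1..M. W M (p + q) j / real j)"
    using sum_bilateral_kernel[where i = "p + q" and g = "\<lambda>_. 1"] assms by simp
  also have "(\<Sum>i=1..p. of_int (pf_coeff p q i) * (\<Sum>n\<in>?I. ?w n * (\<Sum>j\<in>?A n. U \<sigma> M (p + q - i) j / of_int (j - n) ^ i)))
      = (\<Sum>j=1..M. \<Sum>i=1..p. of_int (pf_coeff p q i) * (U \<sigma> M (p + q - i) (int j) * W M i j / real j))"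
    unfolding sum.swap[of _ "{1..M}" "{1..p}", symmetric]
    by (intro sum.cong refl, subst sum_bilateral_kernel) (simp_all add: sum_distrib_left)
  also have "(\<Sum>i=1..q. of_int (pf_coeff q p i) * (\<Sum>n\<in>?I. ?w n * (\<Sum>j\<in>?A n. U \<sigma> M (p + q - i) j / of_int (j - n) ^ i)))
      = (\<Sum>j=1..M. \<Sum>i=1..q. of_int (pf_coeff q p i) * (U \<sigma> M (p + q - i) (int j) * W M i j / real j))"
    unfolding sum.swap[of _ "{1..M}" "{1..q}", symmetric]
    by (intro sum.cong refl, subst sum_bilateral_kernel) (simp_all add: sum_distrib_left)
  finally have *: "(\<Sum>n=1..M. ?w (int n) * (U \<sigma> M p (int n) * U \<sigma> M q (int n))
        + ?w (- int n) * (U \<sigma> M p (- int n) * U \<sigma> M q (- int n)))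
      = (\<Sum>j=1..M. W M (p + q) j / real j)
        + (\<Sum>j=1..M. \<Sum>i=1..p. of_int (pf_coeff p q i) * (U \<sigma> M (p + q - i) (int j) * W M i j / real j))
        + (\<Sum>j=1..M. \<Sum>i=1..q. of_int (pf_coeff q p i) * (U \<sigma> M (p + q - i) (int j) * W M i j / real j))
        - (\<Sum>n=1..M. (kappa p q + kappa q p) * ((-1) ^ n / real n * U \<sigma> M (p + q) (int n)))"
    unfolding sum_int_nonzero .
  have "(\<Sum>n=1..M. defect \<sigma> p q M n / real n)
      = (\<Sum>n=1..M. ?w (int n) * (U \<sigma> M p (int n) * U \<sigma> M q (int n))
        + ?w (- int n) * (U \<sigma> M p (- int n) * U \<sigma> M q (- int n)))
       - ((\<Sum>j=1..M. W M (p + q) j / real j)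
        + (\<Sum>j=1..M. \<Sum>i=1..p. of_int (pf_coeff p q i) * (U \<sigma> M (p + q - i) (int j) * W M i j / real j))
        + (\<Sum>j=1..M. \<Sum>i=1..q. of_int (pf_coeff q p i) * (U \<sigma> M (p + q - i) (int j) * W M i j / real j))
        - (\<Sum>n=1..M. (kappa p q + kappa q p) * ((-1) ^ n / real n * U \<sigma> M (p + q) (int n))))"
    unfolding sum_subtractf[symmetric] sum.distrib[symmetric] defect_def
    by (intro sum.cong refl)
       (simp add: add_divide_distrib diff_divide_distrib sum_divide_distrib right_diff_distrib sign_powi_uminus)
  then show ?thesis unfolding * by simp
qed

section \<open>Passage to the limit\<close>

text \<open>The error bound is chosen so that, weighted with \<open>1/n\<close> and summed over \<open>n \<le> M\<close>, it gives
  \<open>C * 2 * H\<^sub>M / (M + 1)\<close>, which tends to 0.\<close>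

definition approximates :: "(nat \<Rightarrow> nat \<Rightarrow> real) \<Rightarrow> (nat \<Rightarrow> real) \<Rightarrow> bool" where
  "approximates f g \<longleftrightarrow> (\<exists>C. \<forall>M n. 1 \<le> n \<and> n \<le> M \<longrightarrow>
     \<bar>f M n\<bar> \<le> C \<and> \<bar>g n\<bar> \<le> C \<and> \<bar>f M n - g n\<bar> \<le> C / real (M - n + 1))"

lemma approximatesI:
  assumes "\<And>M n. 1 \<le> n \<Longrightarrow> n \<le> M \<Longrightarrow> \<bar>g n\<bar> \<le> A"
    "\<And>M n. 1 \<le> n \<Longrightarrow> n \<le> M \<Longrightarrow> \<bar>f M n - g n\<bar> \<le> B / real (M - n + 1)"
  shows "approximates f g"
  unfolding approximates_def
proof (intro exI[of _ "\<bar>A\<bar> + \<bar>B\<bar>"] allI impI)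
  fix M n :: nat assume n: "1 \<le> n \<and> n \<le> M"
  have d: "B / real (M - n + 1) \<le> \<bar>B\<bar>"
  proof -
    have "B / real (M - n + 1) \<le> \<bar>B\<bar> / real (M - n + 1)" by (intro divide_right_mono) auto
    also have "\<dots> \<le> \<bar>B\<bar> / 1" by (intro divide_left_mono) auto
    finally show ?thesis by simp
  qed
  have "B / real (M - n + 1) \<le> (\<bar>A\<bar> + \<bar>B\<bar>) / real (M - n + 1)"
    by (intro divide_right_mono) auto
  then show "\<bar>f M n\<bar> \<le> \<bar>A\<bar> + \<bar>B\<bar> \<and> \<bar>g n\<bar> \<le> \<bar>A\<bar> + \<bar>B\<bar> \<and> \<bar>f M n - g n\<bar> \<le> (\<bar>A\<bar> + \<bar>B\<bar>) / real (M - n + 1)"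
    using assms[of n M] n d by auto
qed

lemma approximates_cong:
  assumes "approximates f g" "\<And>M n. 1 \<le> n \<Longrightarrow> n \<le> M \<Longrightarrow> f' M n = f M n"
  shows "approximates f' g"
  using assms unfolding approximates_def by simp

lemma approximates_refl: "(\<And>n. 1 \<le> n \<Longrightarrow> \<bar>g n\<bar> \<le> A) \<Longrightarrow> approximates (\<lambda>M. g) g"
  by (rule approximatesI[of _ A _ 0]) auto

lemma approximates_const: "approximates (\<lambda>M n. c) (\<lambda>n. c)"
  by (rule approximates_refl[of _ "\<bar>c\<bar>"]) auto

lemma approximates_add:
  assumes "approximates f g" "approximates f' g'"
  shows "approximates (\<lambda>M n. f M n + f' M n) (\<lambda>n. g n + g' n)"
proof -
  obtain C where C: "\<And>M n. 1 \<le> n \<Longrightarrow> n \<le> M \<Longrightarrow>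
     \<bar>f M n\<bar> \<le> C \<and> \<bar>g n\<bar> \<le> C \<and> \<bar>f M n - g n\<bar> \<le> C / real (M - n + 1)"
    using assms(1) unfolding approximates_def by blast
  obtain D where D: "\<And>M n. 1 \<le> n \<Longrightarrow> n \<le> M \<Longrightarrow>
     \<bar>f' M n\<bar> \<le> D \<and> \<bar>g' n\<bar> \<le> D \<and> \<bar>f' M n - g' n\<bar> \<le> D / real (M - n + 1)"
    using assms(2) unfolding approximates_def by blast
  show ?thesis
  proof (rule approximatesI[of _ "C + D" _ "C + D"])
    fix M n :: nat assume n: "1 \<le> n" "n \<le> M"
    show "\<bar>g n + g' n\<bar> \<le> C + D" using C[OF n] D[OF n] by linarith
    show "\<bar>f M n + f' M n - (g n + g' n)\<bar> \<le> (C + D) / real (M - n + 1)"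
      using C[OF n] D[OF n] unfolding add_divide_distrib by linarith
  qed
qed

text \<open>The error is \<open>f * (f' - g') + (f - g) * g'\<close>; this is where the uniform
  bounds in \<open>approximates\<close> enter.\<close>

lemma approximates_mult:
  assumes "approximates f g" "approximates f' g'"
  shows "approximates (\<lambda>M n. f M n * f' M n) (\<lambda>n. g n * g' n)"
proof -
  obtain C where C: "\<And>M n. 1 \<le> n \<Longrightarrow> n \<le> M \<Longrightarrow>
     \<bar>f M n\<bar> \<le> C \<and> \<bar>g n\<bar> \<le> C \<and> \<bar>f M n - g n\<bar> \<le> C / real (M - n + 1)"
    using assms(1) unfolding approximates_def by blast
  obtain D where D: "\<And>M n. 1 \<le> n \<Longrightarrow> n \<le> M \<Longrightarrow>
     \<bar>f' M n\<bar> \<le> D \<and> \<bar>g' n\<bar> \<le> D \<and> \<bar>f' M n - g' n\<bar> \<le> D / real (M - n + 1)"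
    using assms(2) unfolding approximates_def by blast
  show ?thesis
  proof (rule approximatesI[of _ "C * D" _ "2 * (C * D)"])
    fix M n :: nat assume n: "1 \<le> n" "n \<le> M"
    note c = C[OF n] and d = D[OF n]
    show "\<bar>g n * g' n\<bar> \<le> C * D" unfolding abs_mult using c d by (intro mult_mono) linarith+
    have "\<bar>f M n * f' M n - g n * g' n\<bar> = \<bar>f M n * (f' M n - g' n) + (f M n - g n) * g' n\<bar>"
      by (simp add: algebra_simps)
    also have "\<dots> \<le> \<bar>f M n\<bar> * \<bar>f' M n - g' n\<bar> + \<bar>f M n - g n\<bar> * \<bar>g' n\<bar>"
      unfolding abs_mult[symmetric] by (rule abs_triangle_ineq)
    also have "\<dots> \<le> C * (D / real (M - n + 1)) + C / real (M - n + 1) * D"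
      using c d by (intro add_mono mult_mono) linarith+
    finally show "\<bar>f M n * f' M n - g n * g' n\<bar> \<le> 2 * (C * D) / real (M - n + 1)"
      by simp
  qed
qed

lemma approximates_diff:
  assumes "approximates f g" "approximates f' g'"
  shows "approximates (\<lambda>M n. f M n - f' M n) (\<lambda>n. g n - g' n)"
  using approximates_add[OF assms(1) approximates_mult[OF approximates_const[of "-1"] assms(2)]] by simp

lemma approximates_sum:
  assumes "finite I" "\<And>i. i \<in> I \<Longrightarrow> approximates (f i) (g i)"
  shows "approximates (\<lambda>M n. \<Sum>i\<in>I. f i M n) (\<lambda>n. \<Sum>i\<in>I. g i n)"
  using assms
proof (induction I rule: finite_induct)
  case empty
  then show ?case using approximates_const[of 0] by simp
next
  case (insert i I)
  then show ?case by (simp add: approximates_add)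
qed

text \<open>Telescoping: for \<open>a = sqrt M\<close> and \<open>b = sqrt (M + 1)\<close>, the
  increment \<open>2 * (b - a) = 2 / (a + b)\<close> is at least \<open>1 / b\<close>, hence at
  least \<open>1 / b ^ 2\<close>. Any bound of order below \<open>M\<close> would do.\<close>

lemma harmonic_le_sqrt: "(\<Sum>n=1..M. 1 / real n) \<le> 2 * sqrt (real M)"
proof (induction M)
  case (Suc M)
  let ?a = "sqrt (real M)" and ?b = "sqrt (real (Suc M))"
  have ab: "?a \<le> ?b" "?b \<ge> 1" "?a \<ge> 0" by auto
  have "(?b - ?a) * (?b + ?a) = 1"
    by (simp add: algebra_simps)
  moreover have "(?b - ?a) * (?b + ?a) \<le> (?b - ?a) * (2 * ?b)"
    using ab by (intro mult_left_mono) auto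
  moreover have "(?b - ?a) * (2 * ?b) \<le> (2 * ?b - 2 * ?a) * (?b * ?b)"
  proof -
    have "(?b - ?a) * (2 * ?b) * 1 \<le> (?b - ?a) * (2 * ?b) * ?b"
      using ab by (intro mult_left_mono) auto
    also have "\<dots> = (2 * ?b - 2 * ?a) * (?b * ?b)" by (simp only: algebra_simps)
    finally show ?thesis by simp
  qed
  ultimately have "1 \<le> (2 * ?b - 2 * ?a) * real (Suc M)" by simp
  then have "1 / real (Suc M) \<le> 2 * ?b - 2 * ?a" by (simp add: divide_le_eq)
  then show ?case using Suc.IH by simp
qed simp

text \<open>The weights \<open>1 / n\<close> are not summable, so boundedness and pointwise
  convergence do not suffice; the rate decides.\<close>

lemma approximation_error_tendsto_0:
  assumes "approximates f g"
  shows "(\<lambda>M. (\<Sum>n=1..M. f M n / real n) - (\<Sum>n=1..M. g n / real n)) \<longlonglongrightarrow> 0"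
proof -
  obtain C where C: "\<And>M n. 1 \<le> n \<Longrightarrow> n \<le> M \<Longrightarrow> \<bar>f M n - g n\<bar> \<le> C / real (M - n + 1)"
    using assms unfolding approximates_def by blast
  have bound: "\<bar>(\<Sum>n=1..M. f M n / real n) - (\<Sum>n=1..M. g n / real n)\<bar> \<le> \<bar>C\<bar> * 4 * (1 / sqrt (real M))"
    if "M \<ge> 1" for M
  proof -
    have "\<bar>(\<Sum>n=1..M. f M n / real n) - (\<Sum>n=1..M. g n / real n)\<bar> \<le> (\<Sum>n=1..M. \<bar>f M n / real n - g n / real n\<bar>)"
      unfolding sum_subtractf[symmetric] by (rule sum_abs)
    also have "\<dots> \<le> (\<Sum>n=1..M. \<bar>C\<bar> / real (M + 1) * (1 / real n + 1 / real (M + 1 - n)))"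
    proof (intro sum_mono)
      fix n assume "n \<in> {1..M}"
      then have n: "1 \<le> n" "n \<le> M" by auto
      have "\<bar>f M n / real n - g n / real n\<bar> = \<bar>f M n - g n\<bar> / real n"
        by (simp add: diff_divide_distrib[symmetric])
      also have "\<dots> \<le> \<bar>C\<bar> / real (M - n + 1) / real n"
      proof (intro divide_right_mono)
        have "C / real (M - n + 1) \<le> \<bar>C\<bar> / real (M - n + 1)" by (intro divide_right_mono) auto
        then show "\<bar>f M n - g n\<bar> \<le> \<bar>C\<bar> / real (M - n + 1)" using C[OF n] by linarith
      qed simp
      \<comment> \<open>Partial fractions of \<open>1 / (n * (M + 1 - n))\<close>; both parts sum to
        harmonic numbers.\<close>
      also have "\<dots> = \<bar>C\<bar> / real (M + 1) * (1 / real n + 1 / real (M + 1 - n))"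
        using n by (simp add: of_nat_diff divide_simps)
      finally show "\<bar>f M n / real n - g n / real n\<bar> \<le> \<bar>C\<bar> / real (M + 1) * (1 / real n + 1 / real (M + 1 - n))" .
    qed
    also have "\<dots> = \<bar>C\<bar> / real (M + 1) * ((\<Sum>n=1..M. 1 / real n) + (\<Sum>n=1..M. 1 / real (M + 1 - n)))"
      by (simp only: sum.distrib flip: sum_distrib_left)
    also have "(\<Sum>n=1..M. 1 / real (M + 1 - n)) = (\<Sum>n=1..M. 1 / real n)"
      by (rule sum.reindex_bij_witness[of _ "\<lambda>n. M + 1 - n" "\<lambda>n. M + 1 - n"]) auto
    also have "\<bar>C\<bar> / real (M + 1) * ((\<Sum>n=1..M. 1 / real n) + (\<Sum>n=1..M. 1 / real n))
        \<le> \<bar>C\<bar> / real (M + 1) * (4 * sqrt (real M))"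
      using harmonic_le_sqrt[of M] by (intro mult_left_mono) auto
    also have "\<dots> \<le> \<bar>C\<bar> / real M * (4 * sqrt (real M))"
      using that by (intro mult_right_mono divide_left_mono) auto
    also have "\<dots> = \<bar>C\<bar> * 4 * (1 / sqrt (real M))"
      using that real_div_sqrt[of "real M"] by (simp add: field_simps)
    finally show ?thesis .
  qed
  have "(\<lambda>M. 1 / sqrt (real M)) \<longlonglongrightarrow> 0"
    by (intro tendsto_divide_0[OF tendsto_const] filterlim_at_top_imp_at_infinity
          filterlim_compose[OF sqrt_at_top filterlim_real_sequentially])
  then have lim: "(\<lambda>M. \<bar>C\<bar> * 4 * (1 / sqrt (real M))) \<longlonglongrightarrow> 0"
    using tendsto_mult_right_zero by blast
  show ?thesis
    by (rule tendsto_rabs_zero_cancel, rule tendsto_sandwich[OF _ _ tendsto_const lim])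
       (use bound in \<open>auto intro!: eventually_sequentiallyI[of 1]\<close>)
qed

section \<open>Limits of the finite sums and of the identity between them\<close>

lemma approximates_Z_minus: "admissible \<sigma> k \<Longrightarrow> approximates (\<lambda>M n. Z \<sigma> (M - n) k) (\<lambda>n. Z_lim \<sigma> k)"
  by (rule approximatesI[of _ "\<bar>Z_lim \<sigma> k\<bar>" _ 2], simp) (subst abs_minus_commute, rule Z_error)

lemma approximates_Z_plus:
  assumes "admissible \<sigma> k"
  shows "approximates (\<lambda>M n. Z \<sigma> (M + n) k) (\<lambda>n. Z_lim \<sigma> k)"
proof (rule approximatesI[of _ "\<bar>Z_lim \<sigma> k\<bar>" _ 2])
  fix M n :: nat
  have "\<bar>Z \<sigma> (M + n) k - Z_lim \<sigma> k\<bar> \<le> 2 / real (M + n + 1)"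
    using Z_error[OF assms, of "M + n"] by (simp add: abs_minus_commute)
  also have "\<dots> \<le> 2 / real (M - n + 1)" by (intro divide_left_mono) auto
  finally show "\<bar>Z \<sigma> (M + n) k - Z_lim \<sigma> k\<bar> \<le> 2 / real (M - n + 1)" .
qed auto

definition U_lim :: "real \<Rightarrow> nat \<Rightarrow> nat \<Rightarrow> real" where
  "U_lim \<sigma> k n = Z_lim \<sigma> k + (-1) ^ k * Z \<sigma> (n - 1) k"

definition W_lim :: "nat \<Rightarrow> nat \<Rightarrow> real" where
  "W_lim i n = - ((-1) ^ n + real i) / real n ^ i
     + (-1) ^ n * (\<Sum>t=1..i. (Z_lim (-1) t + (-1) ^ t * Z_lim (-1) t) / real n ^ (i - t))"

lemma approximates_U_pos:
  assumes "admissible \<sigma> k"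
  shows "approximates (\<lambda>M n. U \<sigma> M k (int n)) (U_lim \<sigma> k)"
proof -
  obtain C where C: "\<And>n. \<bar>Z \<sigma> n k\<bar> \<le> C" using Z_bounded[OF assms] by blast
  have "approximates (\<lambda>M n. Z \<sigma> (M - n) k + (-1) ^ k * Z \<sigma> (n - 1) k) (U_lim \<sigma> k)"
    unfolding U_lim_def
    by (intro approximates_add approximates_mult approximates_const approximates_Z_minus assms
          approximates_refl[of "\<lambda>n. Z \<sigma> (n - 1) k" C] C)
  then show ?thesis
    by (rule approximates_cong) (use assms in \<open>auto simp: admissible_def U_pos\<close>)
qed

lemma approximates_U_neg:
  assumes "admissible \<sigma> k"
  shows "approximates (\<lambda>M n. U \<sigma> M k (- int n)) (\<lambda>n. Z_lim \<sigma> k - Z \<sigma> n k)"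
proof -
  obtain C where C: "\<And>n. \<bar>Z \<sigma> n k\<bar> \<le> C" using Z_bounded[OF assms] by blast
  have "approximates (\<lambda>M n. Z \<sigma> (M + n) k - Z \<sigma> n k) (\<lambda>n. Z_lim \<sigma> k - Z \<sigma> n k)"
    by (intro approximates_diff approximates_Z_plus assms approximates_refl[of "\<lambda>n. Z \<sigma> n k" C] C)
  then show ?thesis
    by (rule approximates_cong) (use assms in \<open>auto simp: admissible_def U_neg\<close>)
qed

text \<open>Only alternating sums occur in \<open>W\<close>, so even \<open>t = 1\<close> converges.
  Quotients are rewritten as products with the bounded \<open>1 / n ^ l\<close>, to use closure
  under products.\<close>

lemma approximates_W: "approximates (\<lambda>M n. W M i n) (W_lim i)"
proof -
  have "approximates (\<lambda>M n. W M i n) (\<lambda>n. (- ((-1) ^ n + real i)) * (1 / real n ^ i)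
     + (-1) ^ n * (\<Sum>t=1..i. (Z_lim (-1) t + (-1) ^ t * Z_lim (-1) t) * (1 / real n ^ (i - t))))"
  proof (rule approximates_cong)
    have inv: "approximates (\<lambda>M n. 1 / real n ^ l) (\<lambda>n. 1 / real n ^ l)" for l
      by (rule approximates_refl[of _ 1]) (simp add: divide_le_eq)
    have sgn: "approximates (\<lambda>M n. (-1) ^ n) (\<lambda>n. (-1) ^ n)"
      by (rule approximates_refl[of _ 1]) simp
    have neg: "approximates (\<lambda>M n. - ((-1) ^ n + real i)) (\<lambda>n. - ((-1) ^ n + real i))"
      using approximates_diff[OF approximates_const[of 0] approximates_add[OF sgn approximates_const[of "real i"]]]
      by simp
    show "approximates (\<lambda>M n. (- ((-1) ^ n + real i)) * (1 / real n ^ i)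
     + (-1) ^ n * (\<Sum>t=1..i. (Z (-1) (M + n) t + (-1) ^ t * Z (-1) (M - n) t) * (1 / real n ^ (i - t))))
       (\<lambda>n. (- ((-1) ^ n + real i)) * (1 / real n ^ i)
     + (-1) ^ n * (\<Sum>t=1..i. (Z_lim (-1) t + (-1) ^ t * Z_lim (-1) t) * (1 / real n ^ (i - t))))"
      by (intro approximates_add approximates_mult inv sgn neg approximates_sum approximates_const
            approximates_Z_plus approximates_Z_minus) (auto simp: admissible_def)
  qed (simp add: W_def)
  then show ?thesis by (simp add: W_lim_def[abs_def])
qed

definition defect_lim :: "real \<Rightarrow> nat \<Rightarrow> nat \<Rightarrow> nat \<Rightarrow> real" where
  "defect_lim \<sigma> p q n =
     (-1) ^ n * (U_lim \<sigma> p n * U_lim \<sigma> q n - (Z_lim \<sigma> p - Z \<sigma> n p) * (Z_lim \<sigma> q - Z \<sigma> n q))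
     - W_lim (p + q) n
     - (\<Sum>i=1..p. of_int (pf_coeff p q i) * (U_lim \<sigma> (p + q - i) n * W_lim i n))
     - (\<Sum>i=1..q. of_int (pf_coeff q p i) * (U_lim \<sigma> (p + q - i) n * W_lim i n))
     + (kappa p q + kappa q p) * ((-1) ^ n * U_lim \<sigma> (p + q) n)"

text \<open>The weighted sum of \<open>defect\<close> is 0 for every \<open>M\<close>, and passing
  to \<open>defect_lim\<close> costs an error tending to 0. With \<open>p\<close> and
  \<open>q\<close> at least 2, every exponent \<open>p + q - i\<close> is at least 2, so all limits
  exist.\<close>

lemma defect_lim_sums:
  assumes "sign \<sigma>" "p \<ge> 2" "q \<ge> 2"
  shows "(\<lambda>n. defect_lim \<sigma> p q (Suc n) / real (Suc n)) sums 0"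
proof -
  have sgn: "approximates (\<lambda>M n. (-1) ^ n) (\<lambda>n. (-1) ^ n)"
    by (rule approximates_refl[of _ 1]) simp
  have "approximates (\<lambda>M n. defect \<sigma> p q M n) (defect_lim \<sigma> p q)"
    unfolding defect_def defect_lim_def
    by (intro approximates_add approximates_diff approximates_mult approximates_sum approximates_const
          approximates_U_pos approximates_U_neg approximates_W sgn)
       (use assms in \<open>auto simp: admissible_def\<close>)
  from approximation_error_tendsto_0[OF this]
  have "(\<lambda>M. - (\<Sum>n=1..M. defect_lim \<sigma> p q n / real n)) \<longlonglongrightarrow> 0"
    using sum_defect[of \<sigma> p q] assms by simp
  then have "(\<lambda>M. \<Sum>n=1..M. defect_lim \<sigma> p q n / real n) \<longlonglongrightarrow> 0"
    by (subst (asm) tendsto_minus_cancel_left[symmetric]) simp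
  then show ?thesis
    unfolding sums_def One_nat_def sum.atLeast1_atMost_eq .
qed

section \<open>Reduction to linear sums\<close>

text \<open>\<open>Z \<sigma> (n - 1) k\<close> lacks only the last term of
  \<open>Z \<sigma> n k\<close>, which merges with \<open>\<tau> ^ n / n ^ b\<close> into a power
  sum of sign \<open>\<sigma> * \<tau>\<close>.\<close>

lemma summable_in_algebra_U_lim:
  assumes "sign \<sigma>" "k \<ge> 2" "admissible \<tau> b"
  shows "summable_in_algebra (\<lambda>n. U_lim \<sigma> k n * \<tau> ^ n / real n ^ b)"
proof (rule summable_in_algebra_cong)
  have adm: "admissible \<sigma> k" "admissible (\<sigma> * \<tau>) (k + b)"
    using assms by (auto simp: admissible_def sign_mult)
  show "summable_in_algebra (\<lambda>n. Z_lim \<sigma> k * (\<tau> ^ n / real n ^ b)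
      + of_int ((-1) ^ k) * (Z \<sigma> n k * \<tau> ^ n / real n ^ b - (\<sigma> * \<tau>) ^ n / real n ^ (k + b)))"
    by (intro summable_in_algebra_add summable_in_algebra_mult summable_in_algebra_diff
          summable_in_algebra_linear summable_in_algebra_power Z_lim_in_algebra rat_poly_values_of_int adm assms)
  fix n :: nat assume "n \<ge> 1"
  then obtain m where m: "n = Suc m" by (cases n) auto
  have *: "U_lim \<sigma> k n = Z_lim \<sigma> k + (-1) ^ k * (Z \<sigma> n k - \<sigma> ^ n / real n ^ k)"
    by (simp add: U_lim_def Z_Suc m)
  show "Z_lim \<sigma> k * (\<tau> ^ n / real n ^ b)
      + of_int ((-1) ^ k) * (Z \<sigma> n k * \<tau> ^ n / real n ^ b - (\<sigma> * \<tau>) ^ n / real n ^ (k + b))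
      = U_lim \<sigma> k n * \<tau> ^ n / real n ^ b"
    unfolding *
    by (simp add: algebra_simps add_divide_distrib diff_divide_distrib power_add power_mult_distrib)
qed

text \<open>In the expansion of \<open>W_lim i n / n\<close>, exponent 1 arises only for
  \<open>t = i\<close>, and there with sign \<open>(-1) ^ n\<close>, so every term is admissible.
  \<open>h\<close> stands for 1 or some \<open>U_lim\<close>.\<close>

lemma summable_in_algebra_W_lim:
  assumes "\<And>\<tau> b. admissible \<tau> b \<Longrightarrow> summable_in_algebra (\<lambda>n. h n * \<tau> ^ n / real n ^ b)" "i \<ge> 1"
  shows "summable_in_algebra (\<lambda>n. h n * W_lim i n / real n)"
proof (rule summable_in_algebra_cong)
  have c: "Z_lim (-1) t + of_int ((-1) ^ t) * Z_lim (-1) t \<in> euler_algebra" if "t \<in> {1..i}" for t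
    using that by (intro rat_poly_values_add rat_poly_values_mult Z_lim_in_algebra rat_poly_values_of_int)
      (auto simp: admissible_def)
  show "summable_in_algebra (\<lambda>n. - (h n * (-1) ^ n / real n ^ (i + 1)) - of_int (int i) * (h n * 1 ^ n / real n ^ (i + 1))
      + (\<Sum>t=1..i. (Z_lim (-1) t + of_int ((-1) ^ t) * Z_lim (-1) t) * (h n * (-1) ^ n / real n ^ (i - t + 1))))"
    by (intro summable_in_algebra_add summable_in_algebra_mult summable_in_algebra_diff summable_in_algebra_minus
          summable_in_algebra_sum assms(1) c rat_poly_values_of_int)
       (use assms(2) in \<open>auto simp: admissible_def\<close>)
  fix n :: nat
  show "- (h n * (-1) ^ n / real n ^ (i + 1)) - of_int (int i) * (h n * 1 ^ n / real n ^ (i + 1))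
      + (\<Sum>t=1..i. (Z_lim (-1) t + of_int ((-1) ^ t) * Z_lim (-1) t) * (h n * (-1) ^ n / real n ^ (i - t + 1)))
      = h n * W_lim i n / real n"
    unfolding W_lim_def
    by (simp add: distrib_left add_divide_distrib sum_distrib_left sum_divide_distrib diff_divide_distrib right_diff_distrib mult_ac)
qed

text \<open>As \<open>p + q\<close> is odd, the first product contains
  \<open>- (Z \<sigma> n p * Z \<sigma> n q)\<close>, which the subtraction doubles, while the
  product of the two limits cancels. For even \<open>p + q\<close> the quadratic terms would cancel
  instead.\<close>

lemma quadratic_part:
  assumes "sign \<sigma>" "odd (p + q)" "n \<ge> 1"
  shows "U_lim \<sigma> p n * U_lim \<sigma> q n - (Z_lim \<sigma> p - Z \<sigma> n p) * (Z_lim \<sigma> q - Z \<sigma> n q)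
    = - 2 * (Z \<sigma> n p * Z \<sigma> n q)
      + (1 + (-1) ^ q) * Z_lim \<sigma> p * Z \<sigma> n q + (1 + (-1) ^ p) * Z_lim \<sigma> q * Z \<sigma> n p
      - (-1) ^ q * Z_lim \<sigma> p * (\<sigma> ^ n / real n ^ q) - (-1) ^ p * Z_lim \<sigma> q * (\<sigma> ^ n / real n ^ p)
      + Z \<sigma> n p * (\<sigma> ^ n / real n ^ q) + Z \<sigma> n q * (\<sigma> ^ n / real n ^ p) - 1 / real n ^ (p + q)"
proof -
  obtain m where m: "n = Suc m" using assms(3) by (cases n) auto
  define x where "x = \<sigma> ^ n / real n ^ p"
  define y where "y = \<sigma> ^ n / real n ^ q"
  have 1: "U_lim \<sigma> p n = Z_lim \<sigma> p + (-1) ^ p * (Z \<sigma> n p - x)"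
    "U_lim \<sigma> q n = Z_lim \<sigma> q + (-1) ^ q * (Z \<sigma> n q - y)"
    by (simp_all add: U_lim_def Z_Suc m x_def y_def)
  have "\<sigma> ^ n * \<sigma> ^ n = 1"
    using assms(1) by (auto simp: sign_def simp flip: power_mult_distrib)
  then have 2: "1 / real n ^ (p + q) = x * y"
    by (simp add: x_def y_def power_add)
  have 3: "(-1 :: real) ^ q = - ((-1) ^ p)"
    using assms(2) by (cases "even p") auto
  show ?thesis
    unfolding 1 2 x_def[symmetric] y_def[symmetric] 3 by (cases "even p") (simp_all add: algebra_simps)
qed

lemma summable_in_algebra_quadratic:
  assumes "sign \<sigma>" "p \<ge> 2" "q \<ge> 2" "odd (p + q)"
  shows "summable_in_algebra (\<lambda>n. Z \<sigma> n p * Z \<sigma> n q / real n * (-1) ^ n)"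
proof -
  have adm: "admissible \<sigma> p" "admissible \<sigma> q" "admissible (-1) 1" "admissible (- \<sigma>) (p + 1)"
    "admissible (- \<sigma>) (q + 1)" "admissible (-1) (p + q + 1)"
    using assms by (auto simp: admissible_def sign_def)
  have coeff: "of_int k * Z_lim \<sigma> p \<in> euler_algebra" "of_int k * Z_lim \<sigma> q \<in> euler_algebra" for k
    by (intro rat_poly_values_mult rat_poly_values_of_int Z_lim_in_algebra adm)+
  \<comment> \<open>In this form \<open>kappa\<close> is visibly an integer, hence in the
    algebra.\<close>
  have kappa: "kappa a b = of_int (\<Sum>i=1..a. pf_coeff a b i * (-1) ^ (a + b - i))" for a b
    by (simp add: kappa_def)
  \<comment> \<open>The linear part of \<open>quadratic_part\<close> times
    \<open>(-1) ^ n / n\<close>, with that sign absorbed into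
    \<open>(- \<sigma>) ^ n\<close>.\<close>
  define R where "R n = (of_int (1 + (-1) ^ q) * Z_lim \<sigma> p) * (Z \<sigma> n q * (-1) ^ n / real n ^ 1)
      + (of_int (1 + (-1) ^ p) * Z_lim \<sigma> q) * (Z \<sigma> n p * (-1) ^ n / real n ^ 1)
      - (of_int ((-1) ^ q) * Z_lim \<sigma> p) * ((- \<sigma>) ^ n / real n ^ (q + 1))
      - (of_int ((-1) ^ p) * Z_lim \<sigma> q) * ((- \<sigma>) ^ n / real n ^ (p + 1))
      + Z \<sigma> n p * (- \<sigma>) ^ n / real n ^ (q + 1) + Z \<sigma> n q * (- \<sigma>) ^ n / real n ^ (p + 1)
      - (-1) ^ n / real n ^ (p + q + 1)" for n
  \<comment> \<open>The remaining terms of \<open>defect_lim\<close>, divided by \<open>n\<close>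
    and with opposite sign; the factor 1 fits the form \<open>h n * W_lim i n / n\<close>.\<close>
  define S where "S n = 1 * W_lim (p + q) n / real n
     + (\<Sum>i=1..p. of_int (pf_coeff p q i) * (U_lim \<sigma> (p + q - i) n * W_lim i n / real n))
     + (\<Sum>i=1..q. of_int (pf_coeff q p i) * (U_lim \<sigma> (p + q - i) n * W_lim i n / real n))
     - (kappa p q + kappa q p) * (U_lim \<sigma> (p + q) n * (-1) ^ n / real n ^ 1)" for n
  have R: "summable_in_algebra R"
    unfolding R_def
    by (intro summable_in_algebra_add summable_in_algebra_diff summable_in_algebra_mult coeff
          summable_in_algebra_linear summable_in_algebra_power adm assms)
  have S: "summable_in_algebra S"
    unfolding S_def kappa
    by (intro summable_in_algebra_add summable_in_algebra_diff summable_in_algebra_mult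
          summable_in_algebra_sum summable_in_algebra_W_lim summable_in_algebra_U_lim
          rat_poly_values_add rat_poly_values_of_int finite_atLeastAtMost adm assms)
       (use assms summable_in_algebra_power in auto)
  have "(0 :: real) \<in> euler_algebra" using rat_poly_values_of_int[of 0] by simp
  then have D: "summable_in_algebra (\<lambda>n. defect_lim \<sigma> p q n / real n)"
    unfolding summable_in_algebra_def using defect_lim_sums[OF assms(1-3)] by blast
  show ?thesis
  proof (rule summable_in_algebra_cong)
    \<comment> \<open>With \<open>Q\<close> the quadratic term, \<open>defect_lim / n\<close> is
      \<open>R - 2 * Q - S\<close>; this is solved for \<open>Q\<close>.\<close>
    show "summable_in_algebra (\<lambda>n. of_rat (1 / 2) * (R n - S n - defect_lim \<sigma> p q n / real n))"
      by (intro summable_in_algebra_diff summable_in_algebra_mult rat_poly_values_rat R S D)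
    fix n :: nat assume n: "n \<ge> 1"
    have "(-1) ^ n * (U_lim \<sigma> p n * U_lim \<sigma> q n - (Z_lim \<sigma> p - Z \<sigma> n p) * (Z_lim \<sigma> q - Z \<sigma> n q)) / real n
        = R n - 2 * (Z \<sigma> n p * Z \<sigma> n q / real n * (-1) ^ n)"
      unfolding quadratic_part[OF assms(1,4) n] R_def power_minus[of \<sigma>]
      by (simp add: algebra_simps add_divide_distrib diff_divide_distrib)
    moreover have "defect_lim \<sigma> p q n / real n =
        (-1) ^ n * (U_lim \<sigma> p n * U_lim \<sigma> q n - (Z_lim \<sigma> p - Z \<sigma> n p) * (Z_lim \<sigma> q - Z \<sigma> n q)) / real n - S n"
      unfolding defect_lim_def S_def
      by (simp add: add_divide_distrib diff_divide_distrib sum_divide_distrib mult_ac)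
    ultimately show "of_rat (1 / 2) * (R n - S n - defect_lim \<sigma> p q n / real n)
        = Z \<sigma> n p * Z \<sigma> n q / real n * (-1) ^ n"
      by (simp add: of_rat_divide)
  qed
qed

theorem theorem3p4:
  fixes p m :: nat
  assumes "p \<ge> 2"
  shows "reducible_to_linear_sums
           (\<lambda>n. zeta_part (Suc n) p * zeta_part (Suc n) (p + 2 * m + 1) / real (Suc n) * (-1) ^ n)
       \<and> reducible_to_linear_sums
           (\<lambda>n. L_part (Suc n) p * L_part (Suc n) (p + 2 * m + 1) / real (Suc n) * (-1) ^ n)"
proof -
  have "reducible_to_linear_sums (\<lambda>n. Z \<sigma> (Suc n) p * Z \<sigma> (Suc n) (p + 2 * m + 1) / real (Suc n) * (-1) ^ n)"
    if "sign \<sigma>" for \<sigma>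
  proof -
    \<comment> \<open>At index \<open>Suc n\<close> the sign is \<open>(-1) ^ Suc n\<close>,
      opposite to that in the claim. The two minus signs from \<open>Z_neg\<close> cancel in the
      product.\<close>
    have "summable_in_algebra (\<lambda>n. - (Z \<sigma> n p * Z \<sigma> n (p + 2 * m + 1) / real n * (-1) ^ n))"
      using assms that by (intro summable_in_algebra_minus summable_in_algebra_quadratic) auto
    then show ?thesis
      unfolding summable_in_algebra_def reducible_to_linear_sums_def by simp
  qed
  from this[of 1] this[of "-1"] show ?thesis by (simp add: Z_pos Z_neg)
qed

end
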